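(* Let $0<\alpha<1$, $0<\theta<1$, $\Lambda>0$ be fixed. There exist $c>0$ and $0<R<+\infty$ such that the free interface problem $$\begin{cases} T_t=\Delta T,\quad Y_t=\Lambda\Delta Y, & x<f(t,y),\\ T_t=\Delta T+Y^\alpha,\quad Y_t=\Lambda\Delta Y-Y^\alpha, & f(t,y)<x<g(t,y),\\ T_t=\Delta T,\quad Y=0, & x>g(t,y),\end{cases}$$ with $T(t,f(t,y),y)=\theta$, $Y(t,g(t,y),y)=0$, and $T(t,-\infty,y)=0$, $Y(t,-\infty,y)=T(t,+\infty,y)=1$, admits a one-dimensional traveling wave solution $(c,R,u(\xi),v(\xi))$, $\xi=x+ct$, which verifies $$\begin{cases} u_{\xi\xi}-cu_\xi=0,\quad \Lambda v_{\xi\xi}-cv_\xi=0, & \xi<0,\\ u_{\xi\xi}-cu_\xi=-v^\alpha,\quad \Lambda v_{\xi\xi}-cv_\xi=v^\alpha, & 0<\xi<R,\\ u_{\xi\xi}-cu_\xi=0,\quad v=0, & \xi>R.\end{cases}$$ The functions $u$ and $v$ are continuously differentiable on the real line and such that $$u(-\infty)=0,\quad v(-\infty)=1,\quad u(+\infty)=1,$$ and at the ignition and trailing interfaces, placed respectively at $\xi=0$ and $\xi=R$, $$u(0)=\theta,\qquad v(R)=v_\xi(R)=0.$$ Moreover, with $\theta$ and $\Lambda$ fixed, denoting by $R_\alpha$ the position of the trailing interface of such a traveling wave solution for the given $\alpha$, we have: (i) $0<R_\alpha<+\infty$ for $0<\alpha<1$; (ii) $R_\alpha\to+\infty$ as $\alpha\to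 1$; (iii) as $\alpha\to 0$, $R_\alpha\to R_0$, where $R_0=c_0$ is the unique strictly positive solution of $e^{c_0^2}=\dfrac{1}{1-c_0^2\theta}$.
   Context: The unknowns of the evolution problem are $T(t,x,y)$, $Y(t,x,y)\ge 0$ for $t>0$, $(x,y)$ in a strip $\mathbb{R}\times(-\ell/2,\ell/2)$, and the interfaces $x=f(t,y)$ (ignition interface) and $x=g(t,y)$ (trailing interface), $f<g$; $T$, $Y$ and their normal derivatives are continuous across both interfaces. A one-dimensional traveling wave solution $(c,R,u,v)$ means $T(t,x,y)=u(x+ct)$, $Y(t,x,y)=v(x+ct)$, $f(t,y)=-ct$, $g(t,y)=R-ct$. Throughout $v\ge 0$ (so that $v^\alpha$ makes sense), and solutions are understood to be $C^1$ on $\mathbb{R}$ and infinitely differentiable on $[0,R)$ (one-sided at $0$), so that $\xi=R$ is the first point where $v$ vanishes. In the "Moreover" part, one associates with each $\alpha\in(0,1)$ such a solution and denotes its trailing interface position by $R_\alpha$. *)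

theory Defs
  imports "HOL-Analysis.Analysis"
begin

text \<open>
  Throughout, \<open>Y\<^sup>\<alpha>\<close> is \<open>Y powr \<alpha>\<close>; it is only used for \<open>Y \<ge> 0\<close> and \<open>\<alpha> > 0\<close>, where
  \<open>0 powr \<alpha> = 0\<close> is the intended value.  Unknowns of the evolution problem are curried functions of
  \<open>t\<close>, \<open>x\<close>, \<open>y\<close>, interfaces are functions of \<open>t\<close>, \<open>y\<close>.
\<close>

definition twice_differentiable_at :: "(real \<Rightarrow> real) \<Rightarrow> real \<Rightarrow> bool" where
  "twice_differentiable_at h x \<longleftrightarrow>
     (\<forall>\<^sub>F z in nhds x. h differentiable (at z)) \<and> deriv h differentiable (at x)"

text \<open>
  Infinite differentiability on a set without isolated points; at a boundary point belonging to the
  set the derivatives are the one-sided ones (\<open>D n\<close> is the \<open>n\<close>-th derivative).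
\<close>

definition infinitely_differentiable_on :: "(real \<Rightarrow> real) \<Rightarrow> real set \<Rightarrow> bool" where
  "infinitely_differentiable_on h S \<longleftrightarrow>
     (\<exists>D :: nat \<Rightarrow> real \<Rightarrow> real. (\<forall>x\<in>S. D 0 x = h x) \<and>
        (\<forall>n. \<forall>x\<in>S. (D n has_real_derivative D (Suc n) x) (at x within S)))"

definition d_t :: "(real \<Rightarrow> real \<Rightarrow> real \<Rightarrow> real) \<Rightarrow> real \<Rightarrow> real \<Rightarrow> real \<Rightarrow> real" where
  "d_t W t x y = deriv (\<lambda>s. W s x y) t"

definition d_x :: "(real \<Rightarrow> real \<Rightarrow> real \<Rightarrow> real) \<Rightarrow> real \<Rightarrow> real \<Rightarrow> real \<Rightarrow> real" where
  "d_x W t x y = deriv (\<lambda>z. W t z y) x"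

definition d_y :: "(real \<Rightarrow> real \<Rightarrow> real \<Rightarrow> real) \<Rightarrow> real \<Rightarrow> real \<Rightarrow> real \<Rightarrow> real" where
  "d_y W t x y = deriv (\<lambda>z. W t x z) y"

definition laplacian :: "(real \<Rightarrow> real \<Rightarrow> real \<Rightarrow> real) \<Rightarrow> real \<Rightarrow> real \<Rightarrow> real \<Rightarrow> real" where
  "laplacian W t x y = d_x (d_x W) t x y + d_y (d_y W) t x y"

text \<open>\<open>W\<^sub>t = \<kappa> \<Delta>W + q\<close> at the point \<open>(t, x, y)\<close>, all derivatives involved existing.\<close>

definition heat_eq_at ::
  "real \<Rightarrow> (real \<Rightarrow> real \<Rightarrow> real \<Rightarrow> real) \<Rightarrow> real \<Rightarrow> real \<Rightarrow> real \<Rightarrow> real \<Rightarrow> bool" where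
  "heat_eq_at \<kappa> W q t x y \<longleftrightarrow>
     (\<lambda>s. W s x y) differentiable (at t) \<and>
     twice_differentiable_at (\<lambda>z. W t z y) x \<and>
     twice_differentiable_at (\<lambda>z. W t x z) y \<and>
     d_t W t x y = \<kappa> * laplacian W t x y + q"

abbreviation strip_section :: "real \<Rightarrow> real set" where
  "strip_section l \<equiv> {- l / 2 <..< l / 2}"

definition interface :: "real \<Rightarrow> (real \<Rightarrow> real \<Rightarrow> real) \<Rightarrow> bool" where
  "interface l \<phi> \<longleftrightarrow>
     continuous_on ({0<..} \<times> strip_section l) (\<lambda>(t, y). \<phi> t y) \<and>
     (\<forall>t>0. \<forall>y\<in>strip_section l. \<phi> t differentiable (at y))"

text \<open>
  \<open>W\<close> and its normal derivative are continuous across the interface \<open>x = \<phi>(t, y)\<close>, whose unit normal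
  at \<open>(t, y)\<close> is \<open>(1, -\<phi>\<^sub>y) / sqrt (1 + \<phi>\<^sub>y\<^sup>2)\<close>.  The limit is taken over points on both sides of the
  interface, so its existence says that the two one-sided limits exist and agree.
\<close>

definition C1_across ::
  "real \<Rightarrow> (real \<Rightarrow> real \<Rightarrow> real) \<Rightarrow> (real \<Rightarrow> real \<Rightarrow> real \<Rightarrow> real) \<Rightarrow> bool" where
  "C1_across l \<phi> W \<longleftrightarrow>
     (\<forall>t>0. \<forall>y\<in>strip_section l.
        isCont (\<lambda>(s, x, z). W s x z) (t, \<phi> t y, y) \<and>
        (\<exists>L. ((\<lambda>(s, x, z). (d_x W s x z - deriv (\<phi> t) y * d_y W s x z)
                              / sqrt (1 + (deriv (\<phi> t) y)\<^sup>2)) \<longlongrightarrow> L)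
              (at (t, \<phi> t y, y) within {(s, x, z). x \<noteq> \<phi> s z})))"

definition free_interface_solution ::
  "real \<Rightarrow> real \<Rightarrow> real \<Rightarrow> real \<Rightarrow>
   (real \<Rightarrow> real \<Rightarrow> real \<Rightarrow> real) \<Rightarrow> (real \<Rightarrow> real \<Rightarrow> real \<Rightarrow> real) \<Rightarrow>
   (real \<Rightarrow> real \<Rightarrow> real) \<Rightarrow> (real \<Rightarrow> real \<Rightarrow> real) \<Rightarrow> bool" where
  "free_interface_solution \<alpha> \<theta> \<Lambda> l T Y f g \<longleftrightarrow>
     interface l f \<and> interface l g \<and>
     C1_across l f T \<and> C1_across l g T \<and> C1_across l f Y \<and> C1_across l g Y \<and>
     (\<forall>t>0. \<forall>y\<in>strip_section l.
        f t y < g t y \<and>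
        (\<forall>x. 0 \<le> Y t x y) \<and>
        (\<forall>x. x < f t y \<longrightarrow> heat_eq_at 1 T 0 t x y \<and> heat_eq_at \<Lambda> Y 0 t x y) \<and>
        (\<forall>x. f t y < x \<and> x < g t y \<longrightarrow>
           heat_eq_at 1 T (Y t x y powr \<alpha>) t x y \<and>
           heat_eq_at \<Lambda> Y (- (Y t x y powr \<alpha>)) t x y) \<and>
        (\<forall>x. g t y < x \<longrightarrow> heat_eq_at 1 T 0 t x y \<and> Y t x y = 0) \<and>
        T t (f t y) y = \<theta> \<and>
        Y t (g t y) y = 0 \<and>
        ((\<lambda>x. T t x y) \<longlongrightarrow> 0) at_bot \<and>
        ((\<lambda>x. Y t x y) \<longlongrightarrow> 1) at_bot \<and>
        ((\<lambda>x. T t x y) \<longlongrightarrow> 1) at_top)"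

definition ode_at :: "real \<Rightarrow> real \<Rightarrow> (real \<Rightarrow> real) \<Rightarrow> real \<Rightarrow> real \<Rightarrow> bool" where
  "ode_at \<kappa> c w q \<xi> \<longleftrightarrow>
     twice_differentiable_at w \<xi> \<and> \<kappa> * deriv (deriv w) \<xi> - c * deriv w \<xi> = q"

text \<open>
  The travelling wave system for \<open>(c, R, u, v)\<close>.  That \<open>R\<close> is the first zero of \<open>v\<close> is not imposed:
  it is what smoothness on \<open>[0, R)\<close> amounts to, since \<open>v\<close> loses smoothness where it first reaches \<open>0\<close>.
  The signs of \<open>c\<close> and \<open>R\<close> are not imposed here either.
\<close>

definition travelling_wave ::
  "real \<Rightarrow> real \<Rightarrow> real \<Rightarrow> real \<Rightarrow> real \<Rightarrow> (real \<Rightarrow> real) \<Rightarrow> (real \<Rightarrow> real) \<Rightarrow> bool" where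
  "travelling_wave \<alpha> \<theta> \<Lambda> c R u v \<longleftrightarrow>
     u C1_differentiable_on UNIV \<and> v C1_differentiable_on UNIV \<and>
     infinitely_differentiable_on u {0..<R} \<and> infinitely_differentiable_on v {0..<R} \<and>
     (\<forall>\<xi>. 0 \<le> v \<xi>) \<and>
     (\<forall>\<xi><0. ode_at 1 c u 0 \<xi> \<and> ode_at \<Lambda> c v 0 \<xi>) \<and>
     (\<forall>\<xi>. 0 < \<xi> \<and> \<xi> < R \<longrightarrow>
        ode_at 1 c u (- (v \<xi> powr \<alpha>)) \<xi> \<and> ode_at \<Lambda> c v (v \<xi> powr \<alpha>) \<xi>) \<and>
     (\<forall>\<xi>>R. ode_at 1 c u 0 \<xi> \<and> v \<xi> = 0) \<and>
     (u \<longlongrightarrow> 0) at_bot \<and> (v \<longlongrightarrow> 1) at_bot \<and> (u \<longlongrightarrow> 1) at_top \<and>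
     u 0 = \<theta> \<and> v R = 0 \<and> deriv v R = 0"

end

theory Submission
  imports Defs
begin

text \<open>
  Writing \<open>W(s) = v(R - s)\<close>, a wave is a solution of \<open>\<Lambda> W'' + c W' = W\<^sup>\<alpha>\<close>, \<open>W(0) = W'(0) = 0\<close>, that is positive on
  \<open>(0, R]\<close> and satisfies the two flux conditions \<open>c = \<integral> v\<^sup>\<alpha>\<close> and \<open>c \<theta> = \<integral> exp(- c \<xi>) v\<^sup>\<alpha>\<close> over \<open>[0, R]\<close>.

  Limits: the flux conditions give \<open>c\<^sup>2 \<theta> \<le> 1\<close>, \<open>c \<le> R\<close> and \<open>ln (1/\<theta>) \<le> c R\<close>, and energy estimates show that
  \<open>W\<close> to the power \<open>(1-\<alpha>)/2\<close> lies between two linear functions of \<open>s\<close>.  The upper bound makes \<open>v\<^sup>\<alpha>\<close>, hence \<open>c\<close>,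
  small if \<open>R\<close> stays bounded as \<open>\<alpha> \<rightarrow> 1\<close>; the lower bound makes \<open>v\<^sup>\<alpha> \<rightarrow> 1\<close> as \<open>\<alpha> \<rightarrow> 0\<close>, so the flux conditions
  degenerate to \<open>c = R\<close> and \<open>c\<^sup>2 \<theta> = 1 - exp(- c\<^sup>2)\<close>.

  Existence: scaling removes \<open>c\<close> from the equation.  If \<open>\<omega>\<close> is the positive solution for \<open>c = 1\<close>, the flux
  conditions become one scalar equation for \<open>\<rho> = c R\<close>, solved by the intermediate value theorem.
\<close>

text \<open>The power \<open>\<alpha> < 1\<close> is not Lipschitz at 0, so the zero data at
  \<open>R\<close> do not determine \<open>W\<close>: the zero function satisfies the same initial
  value problem. Every estimate therefore presupposes positivity, and existence needs a subsolution
  that keeps the iterates away from zero. The root exponent comes from the energy: multiplying the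
  equation by \<open>W'\<close> compares \<open>W'^2\<close> with \<open>W^(1+\<alpha>)\<close>, and
  \<open>W' / W^((1+\<alpha>)/2)\<close> is, up to a factor, the derivative of
  \<open>W^((1-\<alpha>)/2)\<close>. The flux conditions are first integrals:
  \<open>\<Lambda> v' - c v\<close> is an antiderivative of \<open>v^\<alpha>\<close>, and
  \<open>- exp(- c x) u'\<close> of its weighted form; the behaviour at both infinities fixes the
  boundary values. Uniqueness of the wave for a given \<open>\<alpha>\<close> is not established, so
  both limits rest on bounds valid for every wave. Positivity of \<open>v\<close> before
  \<open>R\<close> is not part of the definition and has to be extracted from smoothness before
  these bounds reach up to \<open>R\<close>.\<close>

lemma mono_from_deriv:
  fixes f f' :: "real \<Rightarrow> real"
  assumes "a \<le> b" "continuous_on {a..b} f"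
    and "\<And>x. a < x \<Longrightarrow> x < b \<Longrightarrow> (f has_real_derivative f' x) (at x)"
    and "\<And>x. a < x \<Longrightarrow> x < b \<Longrightarrow> 0 \<le> f' x"
  shows "f a \<le> f b"
  by (rule DERIV_nonneg_imp_increasing_open) (use assms in blast)+

lemma antimono_from_deriv:
  fixes f f' :: "real \<Rightarrow> real"
  assumes "a \<le> b" "continuous_on {a..b} f"
    and "\<And>x. a < x \<Longrightarrow> x < b \<Longrightarrow> (f has_real_derivative f' x) (at x)"
    and "\<And>x. a < x \<Longrightarrow> x < b \<Longrightarrow> f' x \<le> 0"
  shows "f b \<le> f a"
  by (rule DERIV_nonpos_imp_decreasing_open) (use assms in blast)+

lemma const_from_deriv:
  fixes f :: "real \<Rightarrow> real"
  assumes "a \<le> b" "continuous_on {a..b} f"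
    and "\<And>x. a < x \<Longrightarrow> x < b \<Longrightarrow> (f has_real_derivative 0) (at x)"
  shows "f b = f a"
proof (rule antisym)
  show "f b \<le> f a"
    by (rule antimono_from_deriv[OF assms]) auto
  show "f a \<le> f b"
    by (rule mono_from_deriv[OF assms]) auto
qed

lemma powr_half_square: "(x powr (p / 2))\<^sup>2 = x powr p" for x p :: real
  by (simp add: power2_eq_square flip: powr_add)

section \<open>Solutions vanishing with their derivative\<close>

text \<open>\<open>Z\<close> plays the role of \<open>W'\<close>. Reversing the direction turns
  transport into friction \<open>c * Z\<close>. Positivity is assumed because it is what excludes
  the zero solution.\<close>

locale vanishing_solution =
  fixes \<alpha> \<Lambda> c L :: real and W Z :: "real \<Rightarrow> real"
  assumes \<alpha>: "0 < \<alpha>" "\<alpha> < 1" and \<Lambda>: "0 < \<Lambda>" and c: "0 < c"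
    and cont_W: "continuous_on {0..L} W" and cont_Z: "continuous_on {0..L} Z"
    and deriv_W: "\<And>s. 0 < s \<Longrightarrow> s < L \<Longrightarrow> (W has_real_derivative Z s) (at s)"
    and deriv_Z: "\<And>s. 0 < s \<Longrightarrow> s < L \<Longrightarrow>
       (Z has_real_derivative (W s powr \<alpha> - c * Z s) / \<Lambda>) (at s)"
    and W_0: "W 0 = 0" and Z_0: "Z 0 = 0"
    and W_pos: "\<And>s. 0 < s \<Longrightarrow> s \<le> L \<Longrightarrow> 0 < W s"
begin

lemma cont_sub: "t \<le> L \<Longrightarrow> continuous_on {0..t} W" "t \<le> L \<Longrightarrow> continuous_on {0..t} Z"
  using cont_W cont_Z by (auto elim!: continuous_on_subset)

lemma W_nonneg: "W s \<ge> 0" if "0 \<le> s" "s \<le> L"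
  using that W_0 W_pos[of s] by (cases "s = 0") auto

lemma cont_W_powr: "continuous_on {0..t} (\<lambda>s. W s powr p)" if "t \<le> L" "0 < p"
  by (rule continuous_on_powr') (use that cont_sub W_nonneg in auto)

text \<open>The integrating factor \<open>exp (c * s / \<Lambda>)\<close> absorbs the friction; what
  remains is the nonnegative reaction.\<close>

lemma Z_nonneg: "0 \<le> Z s" if s: "0 \<le> s" "s \<le> L"
proof -
  have "exp (c * 0 / \<Lambda>) * Z 0 \<le> exp (c * s / \<Lambda>) * Z s"
  proof (rule mono_from_deriv[where f = "\<lambda>s. exp (c * s / \<Lambda>) * Z s"
        and f' = "\<lambda>x. exp (c * x / \<Lambda>) * (W x powr \<alpha> / \<Lambda>)"])
    show "continuous_on {0..s} (\<lambda>s. exp (c * s / \<Lambda>) * Z s)"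
      using cont_sub(2)[OF that(2)] \<Lambda> by (intro continuous_intros) auto
    fix x assume x: "0 < x" "x < s"
    have "((\<lambda>s. exp (c * s / \<Lambda>)) has_real_derivative exp (c * x / \<Lambda>) * (c / \<Lambda>)) (at x)"
      using \<Lambda> by (auto intro!: derivative_eq_intros)
    from DERIV_mult[OF this deriv_Z[of x]]
    show "((\<lambda>s. exp (c * s / \<Lambda>) * Z s) has_real_derivative
        exp (c * x / \<Lambda>) * (W x powr \<alpha> / \<Lambda>)) (at x)"
      using x s \<Lambda> by (simp add: field_simps)
  qed (use s \<Lambda> in auto)
  then show ?thesis
    using Z_0 by (simp add: zero_le_mult_iff)
qed

lemma deriv_energy:
  assumes "0 < s" "s < L"
  shows "((\<lambda>s. \<Lambda> * (Z s)\<^sup>2 / 2) has_real_derivative Z s * (W s powr \<alpha> - c * Z s)) (at s)"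
proof -
  have "((\<lambda>s. (Z s)\<^sup>2) has_real_derivative 2 * ((W s powr \<alpha> - c * Z s) / \<Lambda>) * Z s) (at s)"
    using DERIV_power[OF deriv_Z[OF assms], of 2] by (simp add: mult_ac)
  from DERIV_cdivide[OF DERIV_cmult[OF this, of \<Lambda>], of 2] show ?thesis
    by (rule DERIV_cong) (use \<Lambda> in simp)
qed

lemma deriv_powr_Suc:
  assumes "0 < s" "s < L"
  shows "((\<lambda>s. W s powr (\<alpha> + 1) / (\<alpha> + 1)) has_real_derivative Z s * W s powr \<alpha>) (at s)"
proof -
  have "((\<lambda>s. W s powr (\<alpha> + 1)) has_real_derivative (\<alpha> + 1) * W s powr (\<alpha> + 1 - real 1) * Z s) (at s)"
    by (rule DERIV_fun_powr[OF deriv_W]) (use assms W_pos in auto)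
  from DERIV_cdivide[OF this, of "\<alpha> + 1"] show ?thesis
    using \<alpha> by (simp add: mult.commute)
qed

text \<open>Kinetic minus potential energy starts at 0 and is dissipated at rate
  \<open>c * (Z x)\<^sup>2\<close>.\<close>

lemma energy_le: "\<Lambda> * (Z s)\<^sup>2 / 2 \<le> W s powr (\<alpha> + 1) / (\<alpha> + 1)" if s: "0 \<le> s" "s \<le> L"
proof -
  let ?E = "\<lambda>s. \<Lambda> * (Z s)\<^sup>2 / 2 - W s powr (\<alpha> + 1) / (\<alpha> + 1)"
  have "?E s \<le> ?E 0"
  proof (rule antimono_from_deriv[where f = ?E and f' = "\<lambda>x. - (c * (Z x)\<^sup>2)"])
    show "continuous_on {0..s} ?E"
      by (intro continuous_intros cont_sub cont_W_powr) (use s \<alpha> in auto)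
    fix x assume x: "0 < x" "x < s"
    show "(?E has_real_derivative - (c * (Z x)\<^sup>2)) (at x)"
      using DERIV_diff[OF deriv_energy[of x] deriv_powr_Suc[of x]] x s
      by (simp add: power2_eq_square algebra_simps)
  qed (use s c in auto)
  then show ?thesis using W_0 Z_0 by simp
qed

text \<open>The factor \<open>1 / (\<alpha> + 1)\<close> is given away, so that the constant does
  not depend on \<open>\<alpha>\<close>.\<close>

lemma Z_le: "Z s \<le> sqrt (2 / \<Lambda>) * W s powr ((1 + \<alpha>) / 2)" if s: "0 \<le> s" "s \<le> L"
proof -
  have "W s powr (\<alpha> + 1) / (\<alpha> + 1) \<le> W s powr (\<alpha> + 1)"
    using \<alpha> by (simp add: divide_le_eq mult_le_cancel_left1)
  then have "\<Lambda> * (Z s)\<^sup>2 / 2 \<le> W s powr (\<alpha> + 1)"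
    using energy_le[OF s] by linarith
  then have "(Z s)\<^sup>2 \<le> 2 / \<Lambda> * W s powr (\<alpha> + 1)"
    using \<Lambda> by (simp add: field_simps)
  also have "\<dots> = (sqrt (2 / \<Lambda>) * W s powr ((1 + \<alpha>) / 2))\<^sup>2"
    using \<Lambda> by (simp add: power_mult_distrib powr_half_square add.commute)
  finally show ?thesis
    by (rule power2_le_imp_le) (use \<Lambda> in auto)
qed

text \<open>Lowering the exponent by 1 gives \<open>- (1 + \<alpha>) / 2\<close>, so exactly the
  ratio controlled by the energy bounds appears. The slope \<open>k\<close> is subtracted for
  comparison with a linear function.\<close>

lemma deriv_root:
  assumes "0 < s" "s < L"
  shows "((\<lambda>s. W s powr ((1 - \<alpha>) / 2) - k * s) has_real_derivative
    (1 - \<alpha>) / 2 * (Z s / W s powr ((1 + \<alpha>) / 2)) - k) (at s)"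
proof -
  have *: "(1 - \<alpha>) / 2 - real 1 = - ((1 + \<alpha>) / 2)"
    by (simp add: field_simps)
  have "((\<lambda>s. W s powr ((1 - \<alpha>) / 2)) has_real_derivative
      (1 - \<alpha>) / 2 * W s powr ((1 - \<alpha>) / 2 - real 1) * Z s) (at s)"
    by (rule DERIV_fun_powr[OF deriv_W]) (use assms W_pos in auto)
  from DERIV_diff[OF this DERIV_cmult_Id[of k]] show ?thesis
    unfolding * by (simp add: powr_minus_divide)
qed

lemma W_root_le: "W s powr ((1 - \<alpha>) / 2) \<le> (1 - \<alpha>) / sqrt (2 * \<Lambda>) * s" if s: "0 \<le> s" "s \<le> L"
proof -
  let ?k = "(1 - \<alpha>) / sqrt (2 * \<Lambda>)"
  have k: "?k = (1 - \<alpha>) / 2 * sqrt (2 / \<Lambda>)"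
    using \<Lambda> real_sqrt_mult_self[of 2] by (simp add: real_sqrt_divide real_sqrt_mult field_simps del: real_sqrt_mult_self)
  have "W s powr ((1 - \<alpha>) / 2) - ?k * s \<le> W 0 powr ((1 - \<alpha>) / 2) - ?k * 0"
  proof (rule antimono_from_deriv[where f = "\<lambda>s. W s powr ((1 - \<alpha>) / 2) - ?k * s"
        and f' = "\<lambda>x. (1 - \<alpha>) / 2 * (Z x / W x powr ((1 + \<alpha>) / 2)) - ?k"])
    show "continuous_on {0..s} (\<lambda>s. W s powr ((1 - \<alpha>) / 2) - ?k * s)"
      by (intro continuous_intros cont_W_powr) (use s \<alpha> in auto)
    fix x assume x: "0 < x" "x < s"
    then show "((\<lambda>s. W s powr ((1 - \<alpha>) / 2) - ?k * s) has_real_derivative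
        (1 - \<alpha>) / 2 * (Z x / W x powr ((1 + \<alpha>) / 2)) - ?k) (at x)"
      using s by (intro deriv_root) auto
    have pos: "0 < W x powr ((1 + \<alpha>) / 2)"
      using W_pos[of x] x s by simp
    have "Z x / W x powr ((1 + \<alpha>) / 2) \<le> sqrt (2 / \<Lambda>)"
      using Z_le[of x] x s pos by (simp add: divide_le_eq)
    then have "(1 - \<alpha>) / 2 * (Z x / W x powr ((1 + \<alpha>) / 2)) \<le> (1 - \<alpha>) / 2 * sqrt (2 / \<Lambda>)"
      using \<alpha> by (intro mult_left_mono) auto
    then show "(1 - \<alpha>) / 2 * (Z x / W x powr ((1 + \<alpha>) / 2)) - ?k \<le> 0"
      unfolding k by simp
  qed (use s in auto)
  then show ?thesis using W_0 by simp
qed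

lemma W_eq_root: "W s = (W s powr ((1 - \<alpha>) / 2)) powr (2 / (1 - \<alpha>))" if "0 \<le> W s"
proof -
  have "(1 - \<alpha>) / 2 * (2 / (1 - \<alpha>)) = 1"
    using \<alpha> by simp
  then show ?thesis
    using that by (simp only: powr_powr powr_one)
qed

lemma W_le: "W s \<le> ((1 - \<alpha>) / sqrt (2 * \<Lambda>) * s) powr (2 / (1 - \<alpha>))" if s: "0 \<le> s" "s \<le> L"
  by (subst W_eq_root[OF W_nonneg[OF s]], rule powr_mono2) (use \<alpha> W_root_le[OF s] in auto)

text \<open>Near 0 friction is at most half the reaction: \<open>Z_le\<close> and
  \<open>W_root_le\<close> give \<open>c * Z x \<le> W x powr \<alpha> * (1 - \<alpha>) * c * x /
  \<Lambda>\<close>, and \<open>2 * c * x \<le> \<Lambda>\<close>. The weight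
  \<open>(\<alpha> + 1) / 4\<close> is at most 1/2, so the remaining half of the reaction pays for
  it, and it cancels the denominator \<open>\<alpha> + 1\<close>.\<close>

lemma energy_ge:
  assumes s: "0 \<le> s" "s \<le> L" "2 * c * s \<le> \<Lambda>"
  shows "W s powr (\<alpha> + 1) / 4 \<le> \<Lambda> * (Z s)\<^sup>2 / 2"
proof -
  let ?E = "\<lambda>s. \<Lambda> * (Z s)\<^sup>2 / 2 - (\<alpha> + 1) / 4 * (W s powr (\<alpha> + 1) / (\<alpha> + 1))"
  let ?D = "\<lambda>x. Z x * (W x powr \<alpha> - c * Z x) - (\<alpha> + 1) / 4 * (Z x * W x powr \<alpha>)"
  have "?E 0 \<le> ?E s"
  proof (rule mono_from_deriv[where f = ?E and f' = ?D])
    show "continuous_on {0..s} ?E"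
      by (intro continuous_intros cont_sub cont_W_powr) (use s \<alpha> in auto)
    fix x assume x: "0 < x" "x < s"
    then have W: "0 < W x" and Z: "0 \<le> Z x"
      using W_pos[of x] Z_nonneg[of x] s by auto
    show "(?E has_real_derivative ?D x) (at x)"
      using x s by (intro DERIV_diff deriv_energy DERIV_cmult deriv_powr_Suc) auto
    have "c * Z x \<le> c * (sqrt (2 / \<Lambda>) * W x powr ((1 + \<alpha>) / 2))"
      using c Z_le[of x] x s by (intro mult_left_mono) auto
    also have "W x powr ((1 + \<alpha>) / 2) = W x powr \<alpha> * W x powr ((1 - \<alpha>) / 2)"
      unfolding powr_add[symmetric] by (simp add: add_divide_distrib diff_divide_distrib add.commute)
    also have "c * (sqrt (2 / \<Lambda>) * (W x powr \<alpha> * W x powr ((1 - \<alpha>) / 2)))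
        \<le> c * (sqrt (2 / \<Lambda>) * (W x powr \<alpha> * ((1 - \<alpha>) / sqrt (2 * \<Lambda>) * x)))"
      using c \<Lambda> W_root_le[of x] x s by (intro mult_left_mono) auto
    also have "\<dots> = W x powr \<alpha> * ((1 - \<alpha>) * (c * x / \<Lambda>))"
      using \<Lambda> real_sqrt_mult_self[of \<Lambda>] by (simp add: real_sqrt_divide real_sqrt_mult divide_simps mult_ac)
    also have "\<dots> \<le> W x powr \<alpha> * (1 / 2)"
    proof (intro mult_left_mono)
      have "2 * c * x \<le> 2 * c * s"
        using x c by simp
      then have "c * x / \<Lambda> \<le> 1 / 2"
        using s(3) \<Lambda> by (simp add: field_simps)
      then have "(1 - \<alpha>) * (c * x / \<Lambda>) \<le> 1 * (1 / 2)"
        using \<alpha> c \<Lambda> x by (intro mult_mono) auto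
      then show "(1 - \<alpha>) * (c * x / \<Lambda>) \<le> 1 / 2" by simp
    qed simp
    finally have "c * Z x \<le> W x powr \<alpha> / 2" by simp
    moreover have "(\<alpha> + 1) / 4 * W x powr \<alpha> \<le> 1 / 2 * W x powr \<alpha>"
      using \<alpha> by (intro mult_right_mono) auto
    ultimately have "0 \<le> Z x * (W x powr \<alpha> - c * Z x - (\<alpha> + 1) / 4 * W x powr \<alpha>)"
      using Z by (intro mult_nonneg_nonneg) auto
    then show "0 \<le> ?D x"
      by (simp add: algebra_simps)
  qed (use s in auto)
  moreover have "x / 4 * (p / x) = p / 4" if "x \<noteq> 0" for x p :: real
    using that by simp
  moreover have "\<alpha> + 1 \<noteq> 0"
    using \<alpha> by simp
  ultimately have "(\<alpha> + 1) / 4 * (p / (\<alpha> + 1)) = p / 4" for p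
    by blast
  moreover have "(\<alpha> + 1) / 4 * (W s powr (\<alpha> + 1) / (\<alpha> + 1)) \<le> \<Lambda> * (Z s)\<^sup>2 / 2"
    using \<open>?E 0 \<le> ?E s\<close> W_0 Z_0 by simp
  ultimately show ?thesis by (simp only:)
qed

text \<open>Integrates the lower energy bound through \<open>deriv_root\<close>; the slope is half
  of the one in \<open>W_root_le\<close>.\<close>

lemma W_root_ge:
  assumes s: "0 \<le> s" "s \<le> L" "2 * c * s \<le> \<Lambda>"
  shows "(1 - \<alpha>) / (2 * sqrt (2 * \<Lambda>)) * s \<le> W s powr ((1 - \<alpha>) / 2)"
proof -
  let ?k = "(1 - \<alpha>) / (2 * sqrt (2 * \<Lambda>))"
  let ?r = "1 / sqrt (2 * \<Lambda>)"
  have "W 0 powr ((1 - \<alpha>) / 2) - ?k * 0 \<le> W s powr ((1 - \<alpha>) / 2) - ?k * s"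
  proof (rule mono_from_deriv[where f = "\<lambda>s. W s powr ((1 - \<alpha>) / 2) - ?k * s"
        and f' = "\<lambda>x. (1 - \<alpha>) / 2 * (Z x / W x powr ((1 + \<alpha>) / 2)) - ?k"])
    show "continuous_on {0..s} (\<lambda>s. W s powr ((1 - \<alpha>) / 2) - ?k * s)"
      by (intro continuous_intros cont_W_powr) (use s \<alpha> in auto)
    fix x assume x: "0 < x" "x < s"
    then show "((\<lambda>s. W s powr ((1 - \<alpha>) / 2) - ?k * s) has_real_derivative
        (1 - \<alpha>) / 2 * (Z x / W x powr ((1 + \<alpha>) / 2)) - ?k) (at x)"
      using s by (intro deriv_root) auto
    have pos: "0 < W x powr ((1 + \<alpha>) / 2)"
      using W_pos[of x] x s by simp
    have "2 * c * x \<le> 2 * c * s"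
      using x c by simp
    then have cx: "2 * c * x \<le> \<Lambda>"
      using s(3) by simp
    have "?r * W x powr ((1 + \<alpha>) / 2) \<le> Z x"
    proof (rule power2_le_imp_le)
      have "(?r * W x powr ((1 + \<alpha>) / 2))\<^sup>2 = W x powr (\<alpha> + 1) / (2 * \<Lambda>)"
        using \<Lambda> by (simp add: power_divide powr_half_square add.commute)
      also have "\<dots> \<le> (Z x)\<^sup>2"
        using energy_ge[of x] x s cx \<Lambda> by (simp add: field_simps)
      finally show "(?r * W x powr ((1 + \<alpha>) / 2))\<^sup>2 \<le> (Z x)\<^sup>2" .
    qed (use Z_nonneg[of x] x s in auto)
    then have "?r \<le> Z x / W x powr ((1 + \<alpha>) / 2)"
      using pos by (simp add: le_divide_eq)
    then have "(1 - \<alpha>) / 2 * ?r \<le> (1 - \<alpha>) / 2 * (Z x / W x powr ((1 + \<alpha>) / 2))"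
      using \<alpha> by (intro mult_left_mono) auto
    then show "0 \<le> (1 - \<alpha>) / 2 * (Z x / W x powr ((1 + \<alpha>) / 2)) - ?k"
      by simp
  qed (use s in auto)
  then show ?thesis using W_0 by simp
qed

lemma W_ge:
  assumes s: "0 \<le> s" "s \<le> L" "2 * c * s \<le> \<Lambda>"
  shows "((1 - \<alpha>) / (2 * sqrt (2 * \<Lambda>)) * s) powr (2 / (1 - \<alpha>)) \<le> W s"
  by (subst W_eq_root[OF W_nonneg[OF s(1,2)]], rule powr_mono2) (use \<alpha> \<Lambda> W_root_ge[OF s] s in auto)

end

section \<open>A priori information on travelling waves\<close>

lemma C1_differentiable_on_UNIV_D:
  fixes f :: "real \<Rightarrow> real"
  assumes "f C1_differentiable_on UNIV"
  shows "(f has_real_derivative deriv f x) (at x)" "continuous_on S (deriv f)"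
proof -
  from assms obtain D where D: "\<And>x. (f has_vector_derivative D x) (at x)" "continuous_on UNIV D"
    unfolding C1_differentiable_on_def by auto
  then have "(f has_real_derivative D x) (at x)" for x
    by (simp add: has_real_derivative_iff_has_vector_derivative)
  moreover from this have "deriv f = D"
    by (intro ext DERIV_imp_deriv)
  ultimately show "(f has_real_derivative deriv f x) (at x)" "continuous_on S (deriv f)"
    using continuous_on_subset[OF D(2)] by simp_all
qed

lemma ode_at_deriv:
  assumes "ode_at \<kappa> c w q x" "\<kappa> \<noteq> 0"
  shows "(deriv w has_real_derivative (c * deriv w x + q) / \<kappa>) (at x)"
proof -
  have "deriv w differentiable (at x)" and eq: "\<kappa> * deriv (deriv w) x - c * deriv w x = q"
    using assms by (auto simp: ode_at_def twice_differentiable_at_def)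
  then have "(deriv w has_real_derivative deriv (deriv w) x) (at x)"
    by (simp add: DERIV_deriv_iff_real_differentiable)
  moreover have "deriv (deriv w) x = (c * deriv w x + q) / \<kappa>"
    using eq assms(2) by (simp add: field_simps)
  ultimately show ?thesis by simp
qed

lemma exp_linear_at_bot: "((\<lambda>y. exp (k * y)) \<longlongrightarrow> 0) at_bot" if "0 < k" for k :: real
  by (rule filterlim_compose[OF exp_at_bot])
    (rule filterlim_tendsto_pos_mult_at_bot[OF tendsto_const that filterlim_ident])

text \<open>The combination \<open>\<kappa> * z - c * w\<close> is constant and \<open>z\<close> is
  a multiple of \<open>exp (c / \<kappa> * x)\<close>, which dies out at minus infinity; the limit
  \<open>l\<close> then identifies the constant as \<open>- c * l\<close>.\<close>

lemma flux_left:
  fixes w z :: "real \<Rightarrow> real"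
  assumes "0 < \<kappa>" "0 < c" and cont: "continuous_on {..0} w" "continuous_on {..0} z"
    and w: "\<And>x. x < 0 \<Longrightarrow> (w has_real_derivative z x) (at x)"
    and z: "\<And>x. x < 0 \<Longrightarrow> (z has_real_derivative c * z x / \<kappa>) (at x)"
    and lim: "(w \<longlongrightarrow> l) at_bot" and "x \<le> 0"
  shows "\<kappa> * z x = c * (w x - l)"
proof -
  define K where "K = \<kappa> * z 0 - c * w 0"
  have K: "\<kappa> * z y - c * w y = K" if "y \<le> 0" for y
    unfolding K_def
  proof (rule const_from_deriv[of y 0 "\<lambda>y. \<kappa> * z y - c * w y", symmetric])
    show "continuous_on {y..0} (\<lambda>y. \<kappa> * z y - c * w y)"
      by (intro continuous_intros continuous_on_subset[OF cont(1)] continuous_on_subset[OF cont(2)]) auto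
    fix x assume "y < x" "x < 0"
    from DERIV_diff[OF DERIV_cmult[OF z[OF this(2)], of \<kappa>] DERIV_cmult[OF w[OF this(2)], of c]]
    show "((\<lambda>y. \<kappa> * z y - c * w y) has_real_derivative 0) (at x)"
      using \<open>0 < \<kappa>\<close> by simp
  qed fact
  have E: "z y = z 0 * exp (c / \<kappa> * y)" if "y \<le> 0" for y
  proof -
    have "z 0 * exp (- (c / \<kappa>) * 0) = z y * exp (- (c / \<kappa>) * y)"
    proof (rule const_from_deriv[of y 0 "\<lambda>y. z y * exp (- (c / \<kappa>) * y)"])
      show "continuous_on {y..0} (\<lambda>y. z y * exp (- (c / \<kappa>) * y))"
        by (intro continuous_intros continuous_on_subset[OF cont(2)]) auto
      fix x assume "y < x" "x < 0"
      have "((\<lambda>y. exp (- (c / \<kappa>) * y)) has_real_derivative exp (- (c / \<kappa>) * x) * (- (c / \<kappa>))) (at x)"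
        by (rule DERIV_fun_exp DERIV_cmult_Id)+
      from DERIV_mult[OF z[OF \<open>x < 0\<close>] this]
      show "((\<lambda>y. z y * exp (- (c / \<kappa>) * y)) has_real_derivative 0) (at x)"
        by simp
    qed fact
    moreover have "exp (- (c / \<kappa>) * y) * exp (c / \<kappa> * y) = 1"
      by (simp flip: exp_add)
    ultimately show ?thesis
      by (metis mult.assoc mult.right_neutral mult_zero_right exp_zero)
  qed
  have "((\<lambda>y. (\<kappa> * (z 0 * exp (c / \<kappa> * y)) - K) / c) \<longlongrightarrow> (\<kappa> * (z 0 * 0) - K) / c) at_bot"
    by (rule tendsto_divide[OF tendsto_diff[OF tendsto_mult_left[OF tendsto_mult_left[OF
            exp_linear_at_bot]] tendsto_const] tendsto_const]) (use assms(1,2) in auto)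
  moreover have "\<forall>\<^sub>F y in at_bot. (\<kappa> * (z 0 * exp (c / \<kappa> * y)) - K) / c = w y"
    using eventually_le_at_bot[of 0]
  proof eventually_elim
    case (elim y)
    then have "c * w y = \<kappa> * (z 0 * exp (c / \<kappa> * y)) - K"
      using K[of y] E[of y] by simp
    then show ?case
      using \<open>0 < c\<close> by (simp add: divide_eq_eq mult.commute)
  qed
  ultimately have "(w \<longlongrightarrow> (\<kappa> * (z 0 * 0) - K) / c) at_bot"
    by (rule Lim_transform_eventually)
  then have "l = - K / c"
    using tendsto_unique[OF _ lim] by simp
  then show ?thesis
    using K[OF \<open>x \<le> 0\<close>] \<open>0 < c\<close> by (simp add: algebra_simps)
qed

text \<open>Here \<open>z\<close> is a multiple of the growing exponential, while
  \<open>z - c * w\<close> is constant and \<open>w\<close> converges. Such growth is impossible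
  unless the multiple is zero.\<close>

lemma slope_right:
  fixes w z :: "real \<Rightarrow> real"
  assumes "0 < c" and cont: "continuous_on {R..} w" "continuous_on {R..} z"
    and w: "\<And>x. R < x \<Longrightarrow> (w has_real_derivative z x) (at x)"
    and z: "\<And>x. R < x \<Longrightarrow> (z has_real_derivative c * z x) (at x)"
    and lim: "(w \<longlongrightarrow> l) at_top"
  shows "z R = 0"
proof -
  define K where "K = z R - c * w R"
  have K: "z y - c * w y = K" if "R \<le> y" for y
    unfolding K_def
  proof (rule const_from_deriv[of R y "\<lambda>y. z y - c * w y"])
    show "continuous_on {R..y} (\<lambda>y. z y - c * w y)"
      by (intro continuous_intros continuous_on_subset[OF cont(1)] continuous_on_subset[OF cont(2)]) auto
    fix x assume "R < x" "x < y"
    from DERIV_diff[OF z[OF this(1)] DERIV_cmult[OF w[OF this(1)], of c]]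
    show "((\<lambda>y. z y - c * w y) has_real_derivative 0) (at x)"
      by simp
  qed fact
  have E: "z y * exp (- c * y) = z R * exp (- c * R)" if "R \<le> y" for y
  proof (rule const_from_deriv[of R y "\<lambda>y. z y * exp (- c * y)"])
    show "continuous_on {R..y} (\<lambda>y. z y * exp (- c * y))"
      by (intro continuous_intros continuous_on_subset[OF cont(2)]) auto
    fix x assume "R < x" "x < y"
    have "((\<lambda>y. exp (- c * y)) has_real_derivative exp (- c * x) * (- c)) (at x)"
      by (rule DERIV_fun_exp DERIV_cmult_Id)+
    from DERIV_mult[OF z[OF \<open>R < x\<close>] this]
    show "((\<lambda>y. z y * exp (- c * y)) has_real_derivative 0) (at x)"
      by simp
  qed fact
  have "((\<lambda>y. exp (- c * y)) \<longlongrightarrow> 0) at_top"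
    using exp_linear_at_bot[OF \<open>0 < c\<close>] by (simp add: filterlim_at_bot_mirror)
  then have "((\<lambda>y. (K + c * w y) * exp (- c * y)) \<longlongrightarrow> (K + c * l) * 0) at_top"
    by (rule tendsto_mult[OF tendsto_add[OF tendsto_const tendsto_mult_left[OF lim]]])
  moreover have "\<forall>\<^sub>F y in at_top. (K + c * w y) * exp (- c * y) = z R * exp (- c * R)"
    using eventually_ge_at_top[of R]
  proof eventually_elim
    case (elim y)
    then have "K + c * w y = z y"
      using K[of y] by simp
    then show ?case
      using E[OF elim] by simp
  qed
  ultimately have "((\<lambda>y::real. z R * exp (- c * R)) \<longlongrightarrow> (K + c * l) * 0) at_top"
    by (rule Lim_transform_eventually)
  then show ?thesis
    by (simp add: tendsto_const_iff)
qed

text \<open>The mean value inequality bounds \<open>D k\<close> by the supremum of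
  \<open>D (Suc k)\<close> times the distance to \<open>b\<close>; each use gains one power. The
  induction therefore has to cover all orders \<open>k\<close> at once.\<close>

lemma flat_bound:
  fixes D :: "nat \<Rightarrow> real \<Rightarrow> real"
  assumes "a \<le> b"
    and D: "\<And>n x. x \<in> {a..b} \<Longrightarrow> (D n has_real_derivative D (Suc n) x) (at x within {a..b})"
    and zero: "\<And>n. D n b = 0"
  shows "\<exists>M. \<forall>x\<in>{a..b}. \<bar>D k x\<bar> \<le> M * (b - x) ^ n"
proof (induction n arbitrary: k)
  case 0
  have "continuous_on {a..b} (D k)"
    using D DERIV_continuous continuous_on_eq_continuous_within by blast
  then have "bounded (D k ` {a..b})"
    by (simp add: compact_continuous_image compact_imp_bounded)
  then show ?case
    by (auto simp: bounded_iff)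
next
  case (Suc n)
  from Suc[of "Suc k"] obtain M where M: "\<And>x. x \<in> {a..b} \<Longrightarrow> \<bar>D (Suc k) x\<bar> \<le> M * (b - x) ^ n"
    by blast
  have "\<bar>D k x\<bar> \<le> M * (b - x) ^ Suc n" if x: "x \<in> {a..b}" for x
  proof -
    have M_nonneg: "0 \<le> M * (b - x) ^ n"
      using M[OF x] by linarith
    have "norm (D k b - D k x) \<le> (M * (b - x) ^ n) * norm (b - x)"
    proof (rule field_differentiable_bound)
      show "convex {x..b}" by simp
      fix y assume y: "y \<in> {x..b}"
      then have yab: "y \<in> {a..b}" using x by auto
      show "(D k has_field_derivative D (Suc k) y) (at y within {x..b})"
        by (rule DERIV_subset[OF D[OF yab]]) (use x in auto)
      show "norm (D (Suc k) y) \<le> M * (b - x) ^ n"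
      \<comment> \<open>The sign of \<open>M\<close> is known only if \<open>x < b\<close>; at
        \<open>y = b\<close> the vanishing derivative settles the claim instead.\<close>
      proof (cases "b = y")
        case True
        then show ?thesis using zero M_nonneg by simp
      next
        case False
        then have "0 < (b - x) ^ n" using y by simp
        then have "0 \<le> M" using M_nonneg by (simp add: zero_le_mult_iff)
        then have "M * (b - y) ^ n \<le> M * (b - x) ^ n"
          using y by (intro mult_left_mono power_mono) auto
        then show ?thesis using M[OF yab] by simp
      qed
    qed (use x in auto)
    then show ?thesis
      using zero x by (simp add: mult_ac)
  qed
  then show ?case by blast
qed

text \<open>The family \<open>D\<close> is only known through derivatives within a half-open
  interval. These are unique because each point is a limit of points to its right, so
  \<open>D (Suc n)\<close> must be the derivative of the zero function.\<close>

lemma derivatives_zero: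
  fixes D :: "nat \<Rightarrow> real \<Rightarrow> real"
  assumes D: "\<And>n x. x \<in> {a..<b} \<Longrightarrow> (D n has_real_derivative D (Suc n) x) (at x within {a..<b})"
    and zero: "\<And>x. x \<in> {p..<b} \<Longrightarrow> D 0 x = 0" and "a \<le> p" "x \<in> {p..<b}"
  shows "D n x = 0"
  using \<open>x \<in> {p..<b}\<close>
proof (induction n arbitrary: x)
  case (Suc n)
  have "(D n has_real_derivative D (Suc n) x) (at x within {p..<b})"
    by (rule DERIV_subset[OF D]) (use Suc.prems \<open>a \<le> p\<close> in auto)
  moreover have "(D n has_real_derivative 0) (at x within {p..<b})"
    by (rule has_field_derivative_transform_within[of "\<lambda>_. 0" 0 x _ 1]) (use Suc in auto)
  moreover have "at x within {p..<b} \<noteq> bot"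
  proof -
    have "x islimpt {x<..<b}"
      using Suc.prems by (intro islimpt_greaterThanLessThan1) auto
    then have "x islimpt {p..<b}"
      by (rule islimpt_subset) (use Suc.prems in auto)
    then show ?thesis
      by (simp add: trivial_limit_within)
  qed
  ultimately show ?case
    unfolding has_real_derivative_iff_has_vector_derivative
    using vector_derivative_unique_within by metis
qed (use zero in auto)

text \<open>Only \<open>c\<close> is taken to be positive; \<open>0 < R\<close> and the positivity
  of \<open>v\<close> before \<open>R\<close> are derived in \<open>R_pos\<close> and
  \<open>v_pos\<close>.\<close>

locale wave =
  fixes \<alpha> \<theta> \<Lambda> c R :: real and u v :: "real \<Rightarrow> real"
  assumes \<alpha>: "0 < \<alpha>" "\<alpha> < 1" and \<theta>: "0 < \<theta>" "\<theta> < 1" and \<Lambda>: "0 < \<Lambda>" and c: "0 < c"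
    and travelling_wave: "travelling_wave \<alpha> \<theta> \<Lambda> c R u v"
begin

lemmas wave_facts = travelling_wave[unfolded travelling_wave_def]

lemmas C1 = conjunct1[OF wave_facts] conjunct1[OF conjunct2[OF wave_facts]]

lemmas smooth_v = conjunct1[OF conjunct2[OF conjunct2[OF conjunct2[OF wave_facts]]]]

lemmas deriv_u = C1_differentiable_on_UNIV_D(1)[OF C1(1)]
  and cont_u' = C1_differentiable_on_UNIV_D(2)[OF C1(1)]
  and deriv_v = C1_differentiable_on_UNIV_D(1)[OF C1(2)]
  and cont_v' = C1_differentiable_on_UNIV_D(2)[OF C1(2)]

lemmas cont_u = DERIV_continuous_on[OF has_field_derivative_at_within[OF deriv_u]]
  and cont_v = DERIV_continuous_on[OF has_field_derivative_at_within[OF deriv_v]]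

lemma v_nonneg: "0 \<le> v x"
  and v_R: "v R = 0" and v'_R: "deriv v R = 0" and u_0: "u 0 = \<theta>"
  and v_right: "R < x \<Longrightarrow> v x = 0"
  using wave_facts by auto

lemma deriv_u'_left: "x < 0 \<Longrightarrow> (deriv u has_real_derivative c * deriv u x / 1) (at x)"
  using wave_facts ode_at_deriv[of 1 c u 0 x] by simp

lemma deriv_v'_left: "x < 0 \<Longrightarrow> (deriv v has_real_derivative c * deriv v x / \<Lambda>) (at x)"
  using wave_facts ode_at_deriv[of \<Lambda> c v 0 x] \<Lambda> by simp

lemma deriv_u'_right: "R < x \<Longrightarrow> (deriv u has_real_derivative c * deriv u x) (at x)"
  using wave_facts ode_at_deriv[of 1 c u 0 x] by simp

lemma deriv_u': "0 < x \<Longrightarrow> x < R \<Longrightarrow> (deriv u has_real_derivative c * deriv u x - v x powr \<alpha>) (at x)"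
  using wave_facts ode_at_deriv[of 1 c u "- (v x powr \<alpha>)" x] by simp

lemma deriv_v': "0 < x \<Longrightarrow> x < R \<Longrightarrow> (deriv v has_real_derivative (c * deriv v x + v x powr \<alpha>) / \<Lambda>) (at x)"
  using wave_facts ode_at_deriv[of \<Lambda> c v "v x powr \<alpha>" x] \<Lambda> by simp

lemma v_flux_left: "x \<le> 0 \<Longrightarrow> \<Lambda> * deriv v x = c * (v x - 1)"
  by (rule flux_left[OF \<Lambda> c cont_v cont_v' deriv_v deriv_v'_left]) (use wave_facts in auto)

lemma u'_0: "deriv u 0 = c * \<theta>"
  using flux_left[OF zero_less_one c cont_u cont_u' deriv_u deriv_u'_left, of 0 0] wave_facts by simp

lemma u'_R: "deriv u R = 0"
  by (rule slope_right[OF c cont_u cont_u' deriv_u deriv_u'_right]) (use wave_facts in auto)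

text \<open>For \<open>R \<le> 0\<close> the left flux relation at \<open>R\<close>, where
  \<open>v\<close> and its slope vanish, would read \<open>0 = - c\<close>.\<close>

lemma R_pos: "0 < R"
  using v_flux_left[of R] v_R v'_R c by (cases "R \<le> 0") auto

text \<open>If \<open>v 0 = 0\<close>, the left flux relation forces a negative slope at 0, and
  \<open>v\<close> becomes negative just after it.\<close>

lemma v_0_pos: "0 < v 0"
proof (rule ccontr)
  assume "\<not> 0 < v 0"
  then have "v 0 = 0"
    using v_nonneg[of 0] by simp
  then have "\<Lambda> * deriv v 0 = - c"
    using v_flux_left[of 0] by simp
  then have "deriv v 0 < 0"
    using c \<Lambda> mult_nonneg_nonneg[of \<Lambda> "deriv v 0"] by linarith
  then obtain d where d: "0 < d" "\<And>h. 0 < h \<Longrightarrow> h < d \<Longrightarrow> v (0 + h) < v 0"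
    using DERIV_neg_dec_right[OF deriv_v] by blast
  then have "v (d / 2) < 0"
    using d(2)[of "d / 2"] \<open>v 0 = 0\<close> by simp
  then show False
    using v_nonneg[of "d / 2"] by simp
qed

lemma v'_mono_exp: "exp (- (c / \<Lambda>) * x) * deriv v x \<le> exp (- (c / \<Lambda>) * y) * deriv v y"
  if xy: "0 \<le> x" "x \<le> y" "y \<le> R"
proof (rule mono_from_deriv[where f = "\<lambda>x. exp (- (c / \<Lambda>) * x) * deriv v x"
      and f' = "\<lambda>x. exp (- (c / \<Lambda>) * x) * (v x powr \<alpha> / \<Lambda>)"])
  show "continuous_on {x..y} (\<lambda>x. exp (- (c / \<Lambda>) * x) * deriv v x)"
    by (intro continuous_intros cont_v')
  fix t assume t: "x < t" "t < y"
  have "((\<lambda>y. exp (- (c / \<Lambda>) * y)) has_real_derivative exp (- (c / \<Lambda>) * t) * (- (c / \<Lambda>))) (at t)"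
    by (rule DERIV_fun_exp DERIV_cmult_Id)+
  from DERIV_mult[OF this deriv_v'[of t]]
  show "((\<lambda>x. exp (- (c / \<Lambda>) * x) * deriv v x) has_real_derivative
      exp (- (c / \<Lambda>) * t) * (v t powr \<alpha> / \<Lambda>)) (at t)"
    using t xy \<Lambda> by (simp add: algebra_simps add_divide_distrib)
qed (use xy \<Lambda> in auto)

lemma v'_nonpos: "deriv v x \<le> 0" if "0 \<le> x" "x \<le> R"
  using v'_mono_exp[of x R] that v'_R by (simp add: mult_le_0_iff)

lemma v_antimono: "v y \<le> v x" if "0 \<le> x" "x \<le> y" "y \<le> R"
  by (rule antimono_from_deriv[OF that(2) cont_v deriv_v]) (use that v'_nonpos in auto)

lemma v_le_1: "v x \<le> 1" if "0 \<le> x" "x \<le> R"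
proof -
  have "c * (v 0 - 1) \<le> 0"
    using v_flux_left[of 0] mult_nonneg_nonpos[of \<Lambda> "deriv v 0"] v'_nonpos[of 0] \<Lambda> R_pos by simp
  then have "v 0 \<le> 1"
    using c by (simp add: mult_le_0_iff)
  then show ?thesis
    using v_antimono[of 0 x] that by simp
qed

text \<open>\<open>\<Lambda> * v' - c * v\<close> is an antiderivative that vanishes at
  \<open>R\<close> and, by the left flux relation, equals \<open>- c\<close> at 0.\<close>

lemma has_integral_reaction: "((\<lambda>x. v x powr \<alpha>) has_integral c) {0..R}"
proof -
  let ?f = "\<lambda>x. \<Lambda> * deriv v x - c * v x"
  have "((\<lambda>x. v x powr \<alpha>) has_integral (?f R - ?f 0)) {0..R}"
  proof (rule fundamental_theorem_of_calculus_interior)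
    show "continuous_on {0..R} ?f"
      by (intro continuous_intros cont_v cont_v')
    fix x assume x: "x \<in> {0<..<R}"
    have "(?f has_real_derivative v x powr \<alpha>) (at x)"
      using DERIV_diff[OF DERIV_cmult[OF deriv_v'[of x], of \<Lambda>] DERIV_cmult[OF deriv_v[of x], of c]] x \<Lambda>
      by simp
    then show "(?f has_vector_derivative v x powr \<alpha>) (at x)"
      by (simp add: has_real_derivative_iff_has_vector_derivative)
  qed (use R_pos in simp)
  moreover have "?f R - ?f 0 = c"
    using v_flux_left[of 0] v_R v'_R by (simp add: algebra_simps)
  ultimately show ?thesis by simp
qed

text \<open>The factor \<open>exp (- c * x)\<close> removes the transport term from the equation for
  \<open>u\<close>; the boundary slopes are \<open>c * \<theta>\<close> at 0 and 0 at
  \<open>R\<close>.\<close>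

lemma has_integral_weighted: "((\<lambda>x. exp (- c * x) * v x powr \<alpha>) has_integral c * \<theta>) {0..R}"
proof -
  let ?f = "\<lambda>x. - (exp (- c * x) * deriv u x)"
  have "((\<lambda>x. exp (- c * x) * v x powr \<alpha>) has_integral (?f R - ?f 0)) {0..R}"
  proof (rule fundamental_theorem_of_calculus_interior)
    show "continuous_on {0..R} ?f"
      by (intro continuous_intros cont_u')
    fix x assume x: "x \<in> {0<..<R}"
    have "((\<lambda>y. exp (- c * y)) has_real_derivative exp (- c * x) * (- c)) (at x)"
      by (rule DERIV_fun_exp DERIV_cmult_Id)+
    from DERIV_minus[OF DERIV_mult[OF this deriv_u'[of x]]]
    have "(?f has_real_derivative exp (- c * x) * v x powr \<alpha>) (at x)"
      using x by (simp add: algebra_simps)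
    then show "(?f has_vector_derivative exp (- c * x) * v x powr \<alpha>) (at x)"
      by (simp add: has_real_derivative_iff_has_vector_derivative)
  qed (use R_pos in simp)
  then show ?thesis
    using u'_0 u'_R by simp
qed

section \<open>Bounds on \<open>c\<close> and \<open>R\<close> extracted from the flux
  identities\<close>

lemma reaction_le_1: "v x powr \<alpha> \<le> 1" if "0 \<le> x" "x \<le> R"
  using powr_mono2[of \<alpha> "v x" 1] v_le_1[OF that] v_nonneg[of x] \<alpha> by simp

lemma c_le_R: "c \<le> R"
  using has_integral_le[OF has_integral_reaction has_integral_const_real[of 1 0 R]] reaction_le_1 R_pos
  by simp

lemma has_integral_exp: "((\<lambda>x. exp (- c * x)) has_integral (1 - exp (- c * R)) / c) {0..R}"
proof -
  let ?f = "\<lambda>x. - exp (- c * x) / c"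
  have "((\<lambda>x. exp (- c * x)) has_integral (?f R - ?f 0)) {0..R}"
  proof (rule fundamental_theorem_of_calculus_interior)
    show "continuous_on {0..R} ?f"
      using c by (intro continuous_intros) auto
    fix x assume x: "x \<in> {0<..<R}"
    have "((\<lambda>y. exp (- c * y)) has_real_derivative exp (- c * x) * (- c)) (at x)"
      by (rule DERIV_fun_exp DERIV_cmult_Id)+
    from DERIV_cdivide[OF DERIV_minus[OF this], of c]
    show "(?f has_vector_derivative exp (- c * x)) (at x)"
      using c by (simp add: has_real_derivative_iff_has_vector_derivative[symmetric])
  qed (use R_pos in simp)
  moreover have "?f R - ?f 0 = (1 - exp (- c * R)) / c"
    by (simp add: diff_divide_distrib)
  ultimately show ?thesis by simp
qed

lemma weighted_le: "c * \<theta> \<le> (1 - exp (- c * R)) / c"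
proof (rule has_integral_le[OF has_integral_weighted has_integral_exp])
  fix x assume "x \<in> {0..R}"
  then show "exp (- c * x) * v x powr \<alpha> \<le> exp (- c * x)"
    using reaction_le_1[of x] by simp
qed

text \<open>The weight is at most 1, so the weighted deficit of \<open>v powr \<alpha>\<close> from
  1 is at most the unweighted one, whose integral is \<open>R - c\<close>. Hence
  \<open>R - c\<close> alone controls the error of replacing the reaction by 1.\<close>

lemma weighted_ge: "(1 - exp (- c * R)) / c - c * \<theta> \<le> R - c"
proof (rule has_integral_le)
  show "((\<lambda>x. exp (- c * x) - exp (- c * x) * v x powr \<alpha>) has_integral
      (1 - exp (- c * R)) / c - c * \<theta>) {0..R}"
    by (rule has_integral_diff[OF has_integral_exp has_integral_weighted])
  show "((\<lambda>x. 1 - v x powr \<alpha>) has_integral R - c) {0..R}"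
    using has_integral_diff[OF has_integral_const_real[of 1 0 R] has_integral_reaction] R_pos by simp
  fix x assume x: "x \<in> {0..R}"
  have "exp (- c * x) * (1 - v x powr \<alpha>) \<le> 1 * (1 - v x powr \<alpha>)"
    using reaction_le_1[of x] x c by (intro mult_right_mono) auto
  then show "exp (- c * x) - exp (- c * x) * v x powr \<alpha> \<le> 1 - v x powr \<alpha>"
    by (simp add: algebra_simps)
qed

lemma c_sq_le: "c\<^sup>2 * \<theta> \<le> 1"
proof -
  have "c * (c * \<theta>) \<le> c * ((1 - exp (- c * R)) / c)"
    using weighted_le c by (intro mult_left_mono) auto
  then have "c * (c * \<theta>) \<le> 1 - exp (- c * R)"
    using c by simp
  also have "\<dots> \<le> 1" by simp
  finally show ?thesis
    by (simp add: power2_eq_square mult.assoc)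
qed

text \<open>On \<open>[0, R]\<close> the weight is at least \<open>exp (- c * R)\<close>; dividing
  the two flux identities gives \<open>exp (- c * R) \<le> \<theta>\<close>.\<close>

lemma ln_le: "ln (1 / \<theta>) \<le> c * R"
proof -
  have "exp (- c * R) * c \<le> c * \<theta>"
  proof (rule has_integral_le)
    show "((\<lambda>x. exp (- c * R) * v x powr \<alpha>) has_integral exp (- c * R) * c) {0..R}"
      by (rule has_integral_mult_right[OF has_integral_reaction])
    show "((\<lambda>x. exp (- c * x) * v x powr \<alpha>) has_integral c * \<theta>) {0..R}"
      by (rule has_integral_weighted)
    fix x assume "x \<in> {0..R}"
    then show "exp (- c * R) * v x powr \<alpha> \<le> exp (- c * x) * v x powr \<alpha>"
      using c by (intro mult_right_mono) auto
  qed
  then have "exp (- c * R) \<le> \<theta>"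
    using c by (simp add: mult.commute)
  then have "- c * R \<le> ln \<theta>"
    using \<theta> by (subst ln_ge_iff) auto
  then show ?thesis
    using \<theta> by (simp add: ln_div)
qed

text \<open>Stated for any \<open>b \<le> R\<close> because it is first applied at a hypothetical
  earlier zero, in order to refute it, and only then at \<open>R\<close>.\<close>

lemma reversed_vanishing_solution:
  assumes b: "0 < b" "b \<le> R" "v b = 0" "deriv v b = 0" and pos: "\<And>x. 0 \<le> x \<Longrightarrow> x < b \<Longrightarrow> 0 < v x"
  shows "vanishing_solution \<alpha> \<Lambda> c b (\<lambda>s. v (b - s)) (\<lambda>s. - deriv v (b - s))"
proof
  show "continuous_on {0..b} (\<lambda>s. v (b - s))"
    by (rule continuous_on_compose2[OF cont_v[of UNIV]]) (auto intro!: continuous_intros)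
  show "continuous_on {0..b} (\<lambda>s. - deriv v (b - s))"
    by (rule continuous_on_minus, rule continuous_on_compose2[OF cont_v'[of UNIV]])
      (auto intro!: continuous_intros)
  have D: "((\<lambda>s. b - s) has_real_derivative -1) (at s)" for s
    using DERIV_diff[OF DERIV_const DERIV_ident, of b s] by simp
  fix s assume s: "0 < s" "s < b"
  show "((\<lambda>s. v (b - s)) has_real_derivative - deriv v (b - s)) (at s)"
    using DERIV_chain2[OF deriv_v[of "b - s"] D] by simp
  show "((\<lambda>s. - deriv v (b - s)) has_real_derivative
      (v (b - s) powr \<alpha> - c * - deriv v (b - s)) / \<Lambda>) (at s)"
    using DERIV_minus[OF DERIV_chain2[OF deriv_v'[of "b - s"] D]] s b by (simp add: add.commute)
qed (use b pos \<alpha> \<Lambda> c in auto)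

text \<open>
  Past its first zero \<open>v\<close> vanishes identically, so smoothness up to \<open>R\<close> would make \<open>v\<close> flat there;
  but \<open>v\<close> decays only like a power of the distance to the zero.
\<close>

lemma v_pos: "0 < v x" if "0 \<le> x" "x < R"
proof (rule ccontr)
  assume "\<not> 0 < v x"
  then have x: "v x = 0"
    using v_nonneg[of x] by simp
  \<comment> \<open>The zero set in \<open>[0, R]\<close> is compact, so a first zero
    \<open>b\<close> exists; \<open>v_0_pos\<close> keeps it away from 0.\<close>
  define Q where "Q = {y \<in> {0..R}. v y = 0}"
  have "compact Q"
  proof -
    have "Q = {0..R} \<inter> v -` {0}" by (auto simp: Q_def)
    moreover have "closed ({0..R} \<inter> v -` {0})"
      by (rule continuous_closed_preimage[OF cont_v]) auto
    moreover have "bounded ({0..R} \<inter> v -` {0})"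
      by (rule bounded_subset[OF bounded_closed_interval[of 0 R]]) auto
    ultimately show ?thesis
      by (simp add: compact_eq_bounded_closed)
  qed
  moreover have "x \<in> Q"
    using that x by (simp add: Q_def)
  ultimately obtain b where bQ: "b \<in> Q" and b_min: "\<And>y. y \<in> Q \<Longrightarrow> b \<le> y"
    using compact_attains_inf[of Q] by blast
  have b: "0 < b" "b < R" "v b = 0"
    using bQ b_min[OF \<open>x \<in> Q\<close>] that v_0_pos by (auto simp: Q_def less_le)
  have pos: "0 < v y" if "0 \<le> y" "y < b" for y
    using b_min[of y] that b v_nonneg[of y] by (force simp: Q_def less_le)
  \<comment> \<open>A zero of a nonnegative function is a minimum.\<close>
  have "deriv v b = 0"
    by (rule DERIV_local_min[OF deriv_v zero_less_one]) (use b v_nonneg in auto)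
  interpret W: vanishing_solution \<alpha> \<Lambda> c b "\<lambda>s. v (b - s)" "\<lambda>s. - deriv v (b - s)"
    by (rule reversed_vanishing_solution) (use b pos \<open>deriv v b = 0\<close> in auto)
  obtain D where D0: "\<And>x. x \<in> {0..<R} \<Longrightarrow> D 0 x = v x"
    and D: "\<And>n x. x \<in> {0..<R} \<Longrightarrow> (D n has_real_derivative D (Suc n) x) (at x within {0..<R})"
    using smooth_v unfolding infinitely_differentiable_on_def by blast
  have D_b: "D n b = 0" for n
  proof (rule derivatives_zero[where D = D and a = 0 and b = R and p = b, OF D])
    fix y assume "y \<in> {b..<R}"
    then show "D 0 y = 0"
      using v_antimono[of b y] v_nonneg[of y] b D0[of y] by auto
  qed (use b in auto)
  define \<beta> where "\<beta> = 2 / (1 - \<alpha>)"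
  \<comment> \<open>Flatness of an order beyond the decay exponent:
    \<open>(k * s) powr \<beta> \<le> M * s ^ n\<close> becomes
    \<open>k powr \<beta> \<le> M * s powr (n - \<beta>)\<close>, whose right side tends to
    0.\<close>
  obtain n :: nat where n: "\<beta> < real n"
    using reals_Archimedean2 by blast
  have "\<exists>M. \<forall>x\<in>{0..b}. \<bar>D 0 x\<bar> \<le> M * (b - x) ^ n"
  proof (rule flat_bound)
    show "(D n has_real_derivative D (Suc n) x) (at x within {0..b})" if "x \<in> {0..b}" for n x
      by (rule DERIV_subset[OF D]) (use that b in auto)
  qed (use D_b b in auto)
  then obtain M where M: "\<And>x. x \<in> {0..b} \<Longrightarrow> v x \<le> M * (b - x) ^ n"
    using D0 b by (metis (no_types, opaque_lifting) abs_le_D1 atLeastAtMost_iff atLeastLessThan_iff order_le_less_trans)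
  define k where "k = (1 - \<alpha>) / (2 * sqrt (2 * \<Lambda>))"
  have "0 < k"
    using \<alpha> \<Lambda> by (simp add: k_def)
  have "k powr \<beta> \<le> M * s powr (real n - \<beta>)" if s: "0 < s" "s < b" "s < \<Lambda> / (2 * c)" for s
  proof -
    have "2 * c * s \<le> \<Lambda>"
      using s(3) c by (simp add: field_simps)
    then have "(k * s) powr \<beta> \<le> v (b - s)"
      using W.W_ge[of s] s by (simp add: k_def \<beta>_def)
    also have "\<dots> \<le> M * s ^ n"
      using M[of "b - s"] s by simp
    also have "s ^ n = s powr (real n - \<beta>) * s powr \<beta>"
      using s by (simp flip: powr_add powr_realpow)
    finally show ?thesis
      using s \<open>0 < k\<close> by (simp add: powr_mult flip: mult.assoc)
  qed
  moreover have "\<forall>\<^sub>F s in at_right 0. 0 < s \<and> s < min b (\<Lambda> / (2 * c))"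
    using b \<Lambda> c by (intro eventually_at_rightI[of 0 "min b (\<Lambda> / (2 * c))"]) auto
  ultimately have "\<forall>\<^sub>F s in at_right 0. k powr \<beta> \<le> M * s powr (real n - \<beta>)"
    by (auto elim: eventually_mono)
  moreover have "((\<lambda>s. M * s powr (real n - \<beta>)) \<longlongrightarrow> M * 0) (at_right 0)"
  proof (rule tendsto_mult_left, rule tendsto_zero_powrI)
    show "\<forall>\<^sub>F s::real in at_right 0. 0 \<le> s"
      by (auto intro!: eventually_at_rightI[of 0 1])
  qed (use n in \<open>auto intro!: tendsto_eq_intros\<close>)
  ultimately have "k powr \<beta> \<le> M * 0"
    by (intro tendsto_lowerbound) auto
  then show False
    using \<open>0 < k\<close> by simp
qed

sublocale W: vanishing_solution \<alpha> \<Lambda> c R "\<lambda>s. v (R - s)" "\<lambda>s. - deriv v (R - s)"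
  by (rule reversed_vanishing_solution) (use R_pos v_R v'_R v_pos in auto)

end

section \<open>Limits of the trailing interface\<close>

context wave
begin

text \<open>To be read contrapositively: for fixed \<open>M\<close> the right side tends to 0 as
  \<open>\<alpha>\<close> tends to 1 while the left side stays positive, so \<open>R \<le> M\<close>
  must fail. The cube collects \<open>c \<le> k * M * R\<close> and \<open>R \<le> M\<close> in the
  bound of \<open>c * R\<close>, with
  \<open>k = (1 - \<alpha>) / sqrt (2 * \<Lambda>)\<close>.\<close>

lemma R_large:
  assumes "1 / 2 \<le> \<alpha>" "R \<le> M" "(1 - \<alpha>) / sqrt (2 * \<Lambda>) * M \<le> 1"
  shows "ln (1 / \<theta>) \<le> (1 - \<alpha>) / sqrt (2 * \<Lambda>) * M ^ 3"
proof -
  define k where "k = (1 - \<alpha>) / sqrt (2 * \<Lambda>)"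
  have k: "0 < k" "k * M \<le> 1"
    using \<alpha> \<Lambda> assms(3) by (auto simp: k_def)
  have M: "0 < M"
    using R_pos assms(2) by simp
  have bound: "v x powr \<alpha> \<le> k * M" if x: "x \<in> {0..R}" for x
  proof -
    have "v x \<le> v 0"
      using v_antimono[of 0 x] x by simp
    also have "\<dots> \<le> (k * R) powr (2 / (1 - \<alpha>))"
      using W.W_le[of R] R_pos by (simp add: k_def)
    also have "\<dots> \<le> (k * M) powr (2 / (1 - \<alpha>))"
      using k R_pos assms \<alpha> by (intro powr_mono2) auto
    finally have "v x powr \<alpha> \<le> ((k * M) powr (2 / (1 - \<alpha>))) powr \<alpha>"
      using \<alpha> v_nonneg by (intro powr_mono2) auto
    also have "\<dots> = (k * M) powr (2 / (1 - \<alpha>) * \<alpha>)"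
      by (simp only: powr_powr)
    \<comment> \<open>For \<open>\<alpha> \<ge> 1/2\<close> the exponent is at least 1, and the base
      is at most 1.\<close>
    also have "\<dots> \<le> (k * M) powr 1"
    proof (rule powr_mono')
      show "1 \<le> 2 / (1 - \<alpha>) * \<alpha>"
        using \<alpha> assms(1) by (simp add: le_divide_eq)
    qed (use k M in auto)
    finally show ?thesis using k M by simp
  qed
  have "c \<le> k * M * R"
    using has_integral_le[OF has_integral_reaction has_integral_const_real[of "k * M" 0 R]] bound R_pos
    by (simp add: mult.commute)
  then have "c * R \<le> (k * M * R) * R"
    using R_pos by (intro mult_right_mono) auto
  also have "\<dots> \<le> (k * M * M) * M"
    using R_pos k M assms by (intro mult_mono) auto
  finally show ?thesis
    using ln_le by (simp add: k_def power3_eq_cube mult.assoc)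
qed

text \<open>At distance \<open>d\<close> from the trailing interface \<open>W_ge\<close> bounds
  \<open>v\<close> from below, and monotonicity carries this to \<open>[0, R - d]\<close>. The
  assumption \<open>\<alpha> \<le> 1/2\<close> removes \<open>\<alpha>\<close> from the base through
  \<open>1 - \<alpha> \<ge> 1/2\<close>, and gives \<open>2 / (1 - \<alpha>) \<le> 4\<close> in the
  exponent. For fixed \<open>d\<close> the power tends to 1 as \<open>\<alpha>\<close> tends to
  0.\<close>

lemma R_minus_le:
  assumes "\<alpha> \<le> 1 / 2" "0 < d" "2 * c * d \<le> \<Lambda>" "d / (4 * sqrt (2 * \<Lambda>)) \<le> 1"
  shows "(R - d) * (d / (4 * sqrt (2 * \<Lambda>))) powr (4 * \<alpha>) \<le> c"
proof (cases "R \<le> d")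
  case True
  then have "(R - d) * (d / (4 * sqrt (2 * \<Lambda>))) powr (4 * \<alpha>) \<le> 0"
    by (intro mult_nonpos_nonneg) auto
  then show ?thesis using c by simp
next
  case False
  define b where "b = d / (4 * sqrt (2 * \<Lambda>))"
  have b: "0 < b" "b \<le> 1"
    using assms \<Lambda> by (auto simp: b_def)
  have bound: "b powr (4 * \<alpha>) \<le> v x powr \<alpha>" if x: "x \<in> {0..R - d}" for x
  proof -
    have "b = (1 / 2) / (2 * sqrt (2 * \<Lambda>)) * d"
      by (simp add: b_def)
    also have "\<dots> \<le> (1 - \<alpha>) / (2 * sqrt (2 * \<Lambda>)) * d"
      using assms \<Lambda> by (intro mult_right_mono divide_right_mono) auto
    finally have "b powr (2 / (1 - \<alpha>)) \<le> ((1 - \<alpha>) / (2 * sqrt (2 * \<Lambda>)) * d) powr (2 / (1 - \<alpha>))"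
      using b \<alpha> by (intro powr_mono2) auto
    also have "\<dots> \<le> v (R - d)"
      using W.W_ge[of d] assms False by simp
    also have "\<dots> \<le> v x"
      using v_antimono[of x "R - d"] x assms by simp
    finally have "(b powr (2 / (1 - \<alpha>))) powr \<alpha> \<le> v x powr \<alpha>"
      using \<alpha> by (intro powr_mono2) auto
    moreover have "b powr (4 * \<alpha>) \<le> b powr (2 / (1 - \<alpha>) * \<alpha>)"
    proof (rule powr_mono')
      have "2 / (1 - \<alpha>) \<le> 4"
        using assms(1) by (simp add: divide_le_eq)
      then show "2 / (1 - \<alpha>) * \<alpha> \<le> 4 * \<alpha>"
        using \<alpha> by (intro mult_right_mono) auto
    qed (use b in auto)
    ultimately show ?thesis
      by (simp only: powr_powr)
  qed
  have int: "(\<lambda>x. v x powr \<alpha>) integrable_on {0..R}"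
    using has_integral_reaction by blast
  then have int': "(\<lambda>x. v x powr \<alpha>) integrable_on {0..R - d}"
    by (rule integrable_on_subinterval) (use assms in auto)
  have "(R - d) * b powr (4 * \<alpha>) \<le> integral {0..R - d} (\<lambda>x. v x powr \<alpha>)"
    using has_integral_le[OF has_integral_const_real[of "b powr (4 * \<alpha>)" 0 "R - d"]
        integrable_integral[OF int']] bound False by simp
  also have "\<dots> \<le> integral {0..R} (\<lambda>x. v x powr \<alpha>)"
    by (rule integral_subset_le[OF _ int' int]) (use assms in auto)
  also have "\<dots> = c"
    by (rule integral_unique[OF has_integral_reaction])
  finally show ?thesis
    by (simp add: b_def)
qed

text \<open>Two replacements are made: the reaction by 1, and \<open>exp (- c * R)\<close> by
  \<open>exp (- c\<^sup>2)\<close>. Both errors lie between 0 and \<open>c * (R - c)\<close> and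
  enter with opposite signs, so no factor 2 arises.\<close>

lemma residual_le: "\<bar>1 - \<theta> * c\<^sup>2 - exp (- c\<^sup>2)\<bar> \<le> c * (R - c)"
proof -
  have "c * (c * \<theta>) \<le> c * ((1 - exp (- c * R)) / c)"
    using weighted_le c by (intro mult_left_mono) auto
  then have 1: "0 \<le> 1 - \<theta> * c\<^sup>2 - exp (- c * R)"
    using c by (simp add: power2_eq_square mult_ac)
  have "c * ((1 - exp (- c * R)) / c - c * \<theta>) \<le> c * (R - c)"
    using weighted_ge c by (intro mult_left_mono) auto
  moreover have "c * ((1 - exp (- c * R)) / c - c * \<theta>) = 1 - \<theta> * c\<^sup>2 - exp (- c * R)"
    using c by (simp add: field_simps power2_eq_square)
  ultimately have 2: "1 - \<theta> * c\<^sup>2 - exp (- c * R) \<le> c * (R - c)"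
    by simp
  have "exp (- c * R) = exp (- c\<^sup>2) * exp (- (c * (R - c)))"
    by (simp add: power2_eq_square algebra_simps flip: exp_add)
  moreover have "exp (- c\<^sup>2) * (1 - exp (- (c * (R - c)))) \<le> 1 * (c * (R - c))"
    using exp_ge_add_one_self[of "- (c * (R - c))"] c c_le_R by (intro mult_mono) auto
  moreover have "exp (- c\<^sup>2) * exp (- (c * (R - c))) \<le> exp (- c\<^sup>2) * 1"
    using c c_le_R by (intro mult_left_mono) auto
  ultimately have "0 \<le> exp (- c\<^sup>2) - exp (- c * R)" "exp (- c\<^sup>2) - exp (- c * R) \<le> c * (R - c)"
    by (simp_all add: right_diff_distrib)
  with 1 2 show ?thesis
    by linarith
qed

end

section \<open>The root of the limit equation and the two limits of \<open>R\<close>\<close>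

lemma exp_sq_eq_iff: "exp (x\<^sup>2) = 1 / (1 - x\<^sup>2 * \<theta>) \<longleftrightarrow> 1 - \<theta> * x\<^sup>2 - exp (- x\<^sup>2) = 0" for x \<theta> :: real
proof
  assume eq: "exp (x\<^sup>2) = 1 / (1 - x\<^sup>2 * \<theta>)"
  \<comment> \<open>A zero denominator creates no spurious root: division by zero yields 0, and
    \<open>exp\<close> is positive.\<close>
  then have "exp (- x\<^sup>2) = 1 - x\<^sup>2 * \<theta>"
    by (simp add: exp_minus)
  then show "1 - \<theta> * x\<^sup>2 - exp (- x\<^sup>2) = 0"
    by (simp add: mult.commute)
next
  assume "1 - \<theta> * x\<^sup>2 - exp (- x\<^sup>2) = 0"
  then have "1 - x\<^sup>2 * \<theta> = exp (- x\<^sup>2)"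
    by (simp add: mult.commute)
  then show "exp (x\<^sup>2) = 1 / (1 - x\<^sup>2 * \<theta>)"
    by (simp add: exp_minus inverse_eq_divide)
qed

text \<open>In the variable \<open>x\<^sup>2\<close> the function vanishes at 0, rises up to its
  critical point and is nonpositive at \<open>1 / \<theta>\<close>, which gives a positive root. Its
  derivative is injective, which gives uniqueness.\<close>

lemma limit_speed:
  fixes \<theta> :: real
  assumes \<theta>: "0 < \<theta>" "\<theta> < 1"
  shows "\<exists>!x. 0 < x \<and> 1 - \<theta> * x\<^sup>2 - exp (- x\<^sup>2) = 0"
proof -
  define \<phi> where "\<phi> x = 1 - \<theta> * x - exp (- x)" for x
  have D: "(\<phi> has_real_derivative - \<theta> + exp (- x)) (at x)" for x
    unfolding \<phi>_def by (auto intro!: derivative_eq_intros)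
  have cont: "continuous_on S \<phi>" for S
    by (rule DERIV_continuous_on[OF has_field_derivative_at_within[OF D]])
  \<comment> \<open>The critical point, where \<open>exp (- x) = \<theta>\<close>.\<close>
  define x1 where "x1 = ln (1 / \<theta>)"
  have x1: "0 < x1" "x1 \<le> 1 / \<theta>"
    using \<theta> ln_le_minus_one[of "1 / \<theta>"] by (auto simp: x1_def)
  have "\<phi> 0 < \<phi> x1"
  proof (rule DERIV_pos_imp_increasing_open[OF x1(1) _ cont])
    fix x assume "0 < x" "x < x1"
    then have "exp (- x1) < exp (- x)" by simp
    moreover have "exp (- x1) = \<theta>"
      using \<theta> by (simp add: x1_def ln_div)
    ultimately show "\<exists>y. (\<phi> has_real_derivative y) (at x) \<and> 0 < y"
      using D[of x] by (intro exI[of _ "- \<theta> + exp (- x)"]) auto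
  qed
  then have "0 \<le> \<phi> x1"
    by (simp add: \<phi>_def)
  moreover have "\<phi> (1 / \<theta>) \<le> 0"
    using \<theta> by (simp add: \<phi>_def)
  ultimately obtain y where y: "x1 \<le> y" "\<phi> y = 0"
    using IVT2'[of \<phi> "1 / \<theta>" 0 x1] x1 cont by blast
  \<comment> \<open>Together with the root 0, two positive roots would give two critical points by
    Rolle.\<close>
  have no_two: False if ab: "0 < a" "a < b" "\<phi> a = 0" "\<phi> b = 0" for a b
  proof -
    have diff: "\<phi> differentiable (at x)" for x
      using D real_differentiable_def by blast
    have eq: "\<phi> 0 = \<phi> a" "\<phi> a = \<phi> b"
      using ab by (simp_all add: \<phi>_def[of 0])
    obtain p where p: "0 < p" "p < a" "(\<phi> has_real_derivative 0) (at p)"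
      using Rolle[OF ab(1) eq(1) cont diff] by blast
    obtain q where q: "a < q" "(\<phi> has_real_derivative 0) (at q)"
      using Rolle[OF ab(2) eq(2) cont diff] by blast
    have "- \<theta> + exp (- p) = 0" "- \<theta> + exp (- q) = 0"
      using DERIV_unique[OF D] p q by blast+
    then have "exp (- p) = exp (- q)" by simp
    then show False using p q by simp
  qed
  have uniq: "a = b" if "0 < a" "\<phi> (a\<^sup>2) = 0" "0 < b" "\<phi> (b\<^sup>2) = 0" for a b
  proof -
    have "a\<^sup>2 = b\<^sup>2"
      using no_two[of "a\<^sup>2" "b\<^sup>2"] no_two[of "b\<^sup>2" "a\<^sup>2"] that
      by (metis linorder_neqE_linordered_idom zero_less_power)
    then show ?thesis
      using that by simp
  qed
  have "0 < sqrt y \<and> \<phi> ((sqrt y)\<^sup>2) = 0"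
    using y x1 by simp
  then show ?thesis
    using uniq unfolding \<phi>_def by blast
qed

lemma filterlim_interface_at_top:
  assumes \<theta>: "0 < \<theta>" "\<theta> < 1" and \<Lambda>: "0 < \<Lambda>"
    and wave: "\<And>\<alpha>. 0 < \<alpha> \<Longrightarrow> \<alpha> < 1 \<Longrightarrow> wave \<alpha> \<theta> \<Lambda> (c \<alpha>) (R \<alpha>) (u \<alpha>) (v \<alpha>)"
  shows "filterlim R at_top (at_left 1)"
  unfolding filterlim_at_top_gt[where c = 0]
proof (intro allI impI)
  fix M :: real assume "0 < M"
  have lim: "((\<lambda>\<alpha>. (1 - \<alpha>) / sqrt (2 * \<Lambda>) * K) \<longlongrightarrow> (1 - 1) / sqrt (2 * \<Lambda>) * K) (at_left 1)" for K
    by (intro tendsto_intros) (use \<Lambda> in auto)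
  have "0 < ln (1 / \<theta>)"
    using \<theta> by simp
  then have "\<forall>\<^sub>F \<alpha> in at_left 1. (1 - \<alpha>) / sqrt (2 * \<Lambda>) * M ^ 3 < ln (1 / \<theta>)"
    using order_tendstoD(2)[OF lim] by simp
  moreover have "\<forall>\<^sub>F \<alpha> in at_left 1. (1 - \<alpha>) / sqrt (2 * \<Lambda>) * M < 1"
    using order_tendstoD(2)[OF lim] by simp
  moreover have "\<forall>\<^sub>F \<alpha> in at_left 1. 1 / 2 < \<alpha> \<and> \<alpha> < (1::real)"
    by (auto intro!: eventually_at_leftI[of "1 / 2"])
  ultimately show "\<forall>\<^sub>F \<alpha> in at_left 1. M \<le> R \<alpha>"
  proof eventually_elim
    case (elim \<alpha>)
    then interpret wave \<alpha> \<theta> \<Lambda> "c \<alpha>" "R \<alpha>" "u \<alpha>" "v \<alpha>"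
      by (intro wave) auto
    show ?case
      using R_large[of M] elim by linarith
  qed
qed

text \<open>A compactness argument: the speeds eventually lie in a compact interval of positive
  numbers, the residual of the limit equation tends to 0 along them, and away from \<open>c0\<close>
  it is bounded below on that interval. Since \<open>R - c\<close> also tends to 0, \<open>R\<close>
  follows \<open>c\<close>.\<close>

lemma tendsto_interface:
  assumes \<theta>: "0 < \<theta>" "\<theta> < 1" and \<Lambda>: "0 < \<Lambda>"
    and wave: "\<And>\<alpha>. 0 < \<alpha> \<Longrightarrow> \<alpha> < 1 \<Longrightarrow> wave \<alpha> \<theta> \<Lambda> (c \<alpha>) (R \<alpha>) (u \<alpha>) (v \<alpha>)"
    and c0: "0 < c0" "1 - \<theta> * c0\<^sup>2 - exp (- c0\<^sup>2) = 0"
  shows "(R \<longlongrightarrow> c0) (at_right 0)"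
proof -
  define C where "C = 1 / sqrt \<theta>"
  have "0 < C"
    using \<theta> by (simp add: C_def)
  have c_le: "c \<alpha> \<le> C" and c_pos: "0 < c \<alpha>" and speed_le_R: "c \<alpha> \<le> R \<alpha>"
    if "0 < \<alpha>" "\<alpha> < 1" for \<alpha>
  proof -
    interpret wave \<alpha> \<theta> \<Lambda> "c \<alpha>" "R \<alpha>" "u \<alpha>" "v \<alpha>"
      using that by (intro wave)
    show "c \<alpha> \<le> C"
    proof (rule power2_le_imp_le)
      show "(c \<alpha>)\<^sup>2 \<le> C\<^sup>2"
        using c_sq_le \<theta> by (simp add: C_def power_divide le_divide_eq)
    qed (use \<open>0 < C\<close> in simp)
    show "0 < c \<alpha>" by (rule c)
    show "c \<alpha> \<le> R \<alpha>" by (rule c_le_R)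
  qed
  have small: "\<forall>\<^sub>F \<alpha> in at_right 0. 0 < \<alpha> \<and> \<alpha> < 1 / (2::real)"
    by (auto intro!: eventually_at_rightI[of 0 "1 / 2"])
  have gap: "\<forall>\<^sub>F \<alpha> in at_right 0. R \<alpha> - c \<alpha> < e" if "0 < e" for e
  proof -
    \<comment> \<open>Half of \<open>e\<close> is spent on \<open>d\<close>; the other two bounds
      provide \<open>2 * c * d \<le> \<Lambda>\<close> for every \<open>c \<le> C\<close>, and
      \<open>b \<le> 1\<close>. The other half of \<open>e\<close> pays for
      \<open>C * (b powr (- (4 * \<alpha>)) - 1)\<close>, which tends to 0.\<close>
    define d where "d = min (e / 2) (min (\<Lambda> / (2 * C)) (4 * sqrt (2 * \<Lambda>)))"
    define b where "b = d / (4 * sqrt (2 * \<Lambda>))"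
    have d: "0 < d" "d \<le> e / 2" "d \<le> \<Lambda> / (2 * C)" "d \<le> 4 * sqrt (2 * \<Lambda>)"
      using \<open>0 < e\<close> \<Lambda> \<open>0 < C\<close> by (auto simp: d_def)
    have b: "0 < b" "b \<le> 1"
      using d \<Lambda> by (auto simp: b_def divide_le_eq)
    have "((\<lambda>\<alpha>. C * (b powr (- (4 * \<alpha>)) - 1)) \<longlongrightarrow> C * (b powr (- (4 * 0)) - 1)) (at_right 0)"
      using b by (intro tendsto_intros) auto
    then have "\<forall>\<^sub>F \<alpha> in at_right 0. C * (b powr (- (4 * \<alpha>)) - 1) < e / 2"
      by (rule order_tendstoD(2)) (use b \<open>0 < e\<close> in auto)
    with small show ?thesis
    proof eventually_elim
      case (elim \<alpha>)
      then interpret wave \<alpha> \<theta> \<Lambda> "c \<alpha>" "R \<alpha>" "u \<alpha>" "v \<alpha>"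
        by (intro wave) auto
      have "2 * c \<alpha> * d \<le> 2 * C * (\<Lambda> / (2 * C))"
        using c_le[of \<alpha>] c d \<open>0 < C\<close> elim by (intro mult_mono) auto
      then have "(R \<alpha> - d) * b powr (4 * \<alpha>) \<le> c \<alpha>"
        using R_minus_le[of d] elim d b \<open>0 < C\<close> by (simp add: b_def)
      then have "R \<alpha> - d \<le> c \<alpha> * b powr (- (4 * \<alpha>))"
        using b by (simp add: powr_minus_divide le_divide_eq)
      moreover have "1 \<le> b powr (- (4 * \<alpha>))"
        using powr_mono'[of "- (4 * \<alpha>)" 0 b] b elim by simp
      then have "c \<alpha> * (b powr (- (4 * \<alpha>)) - 1) \<le> C * (b powr (- (4 * \<alpha>)) - 1)"
        using c_le[of \<alpha>] elim by (intro mult_right_mono) auto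
      ultimately show ?case
        using elim d by (simp add: right_diff_distrib)
    qed
  qed
  \<comment> \<open>From \<open>ln (1 / \<theta>) \<le> c * R\<close> and eventually
    \<open>R \<le> C + 1\<close>. This lower bound keeps the speeds away from 0, the trivial root of
    the limit equation.\<close>
  define m where "m = ln (1 / \<theta>) / (C + 1)"
  have "0 < m"
    using \<theta> \<open>0 < C\<close> by (simp add: m_def)
  have m_le: "\<forall>\<^sub>F \<alpha> in at_right 0. m \<le> c \<alpha>"
    using small gap[OF zero_less_one]
  proof eventually_elim
    case (elim \<alpha>)
    then interpret wave \<alpha> \<theta> \<Lambda> "c \<alpha>" "R \<alpha>" "u \<alpha>" "v \<alpha>"
      by (intro wave) auto
    have "c \<alpha> * R \<alpha> \<le> c \<alpha> * (C + 1)"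
      using c_le[of \<alpha>] c elim by (intro mult_left_mono) auto
    then have "ln (1 / \<theta>) \<le> c \<alpha> * (C + 1)"
      using ln_le by simp
    then show ?case
      using \<open>0 < C\<close> by (simp add: m_def divide_le_eq)
  qed
  have c_lim: "\<forall>\<^sub>F \<alpha> in at_right 0. \<bar>c \<alpha> - c0\<bar> < e" if "0 < e" for e
  proof -
    define K where "K = {m..C} - {c0 - e<..<c0 + e}"
    define \<phi> where "\<phi> x = \<bar>1 - \<theta> * x\<^sup>2 - exp (- x\<^sup>2)\<bar>" for x
    have "\<exists>\<mu>>0. \<forall>x\<in>K. \<mu> \<le> \<phi> x"
    proof (cases "K = {}")
      case False
      have "compact K"
        unfolding K_def by (rule compact_diff) auto
      moreover have "continuous_on K \<phi>"
        unfolding \<phi>_def by (intro continuous_intros)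
      ultimately obtain x where x: "x \<in> K" "\<forall>y\<in>K. \<phi> x \<le> \<phi> y"
        using continuous_attains_inf[of K \<phi>] False by blast
      have "0 < x" "x \<noteq> c0"
        using x(1) \<open>0 < m\<close> \<open>0 < e\<close> by (auto simp: K_def)
      then have "1 - \<theta> * x\<^sup>2 - exp (- x\<^sup>2) \<noteq> 0"
        using limit_speed[OF \<theta>] c0 by blast
      then have "0 < \<phi> x"
        by (simp add: \<phi>_def)
      then show ?thesis using x by blast
    qed (auto intro: exI[of _ 1])
    then obtain \<mu> where \<mu>: "0 < \<mu>" "\<And>x. x \<in> K \<Longrightarrow> \<mu> \<le> \<phi> x"
      by blast
    have "0 < \<mu> / C"
      using \<mu> \<open>0 < C\<close> by simp
    from gap[OF this] small m_le show ?thesis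
    proof eventually_elim
      case (elim \<alpha>)
      then interpret wave \<alpha> \<theta> \<Lambda> "c \<alpha>" "R \<alpha>" "u \<alpha>" "v \<alpha>"
        by (intro wave) auto
      have "\<phi> (c \<alpha>) \<le> C * (R \<alpha> - c \<alpha>)"
      proof -
        have "c \<alpha> * (R \<alpha> - c \<alpha>) \<le> C * (R \<alpha> - c \<alpha>)"
          using c_le[of \<alpha>] speed_le_R[of \<alpha>] elim by (intro mult_right_mono) auto
        then show ?thesis
          using residual_le by (simp add: \<phi>_def)
      qed
      also have "\<dots> < \<mu>"
        using elim(1) \<open>0 < C\<close> by (simp add: less_divide_eq mult.commute)
      finally have "c \<alpha> \<notin> K"
        using \<mu>(2) by fastforce
      then show ?case
        using elim c_le[of \<alpha>] by (auto simp: K_def)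
    qed
  qed
  show ?thesis
  proof (rule tendstoI)
    fix e :: real assume "0 < e"
    then have "0 < e / 2" by simp
    from gap[OF this] c_lim[OF this] small
    show "\<forall>\<^sub>F \<alpha> in at_right 0. dist (R \<alpha>) c0 < e"
    proof eventually_elim
      case (elim \<alpha>)
      then show ?case
        using speed_le_R[of \<alpha>] unfolding dist_real_def by linarith
    qed
  qed
qed

section \<open>Existence of the vanishing profile\<close>

text \<open>A function vanishing on the left allows the base point to be moved from 0 to any
  \<open>a \<le> 0\<close>. For negative \<open>t\<close> the interval \<open>{0..t}\<close> is
  empty and its integral is 0, in agreement.\<close>

lemma integral_from_0:
  fixes \<phi> :: "real \<Rightarrow> real"
  assumes zero: "\<And>r. r \<le> 0 \<Longrightarrow> \<phi> r = 0" and int: "\<And>t. \<phi> integrable_on {0..t}" and a: "a \<le> 0"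
  shows "\<phi> integrable_on {a..t}" "integral {a..t} \<phi> = integral {0..t} \<phi>"
proof -
  have neg: "(\<phi> has_integral 0) {a..s}" if "s \<le> 0" for s
    by (rule has_integral_is_0) (use zero that in auto)
  have "\<phi> integrable_on {a..t} \<and> integral {a..t} \<phi> = integral {0..t} \<phi>"
  proof (cases "t \<le> 0")
    case True
    have "integral {0..t} \<phi> = 0"
      by (rule integral_unique, rule has_integral_is_0) (use zero True in auto)
    then show ?thesis
      using neg[OF True] by (auto simp: integral_unique)
  next
    case False
    have "\<phi> integrable_on {a..0}" "integral {a..0} \<phi> = 0"
      using neg[of 0] by (auto simp: integral_unique)
    moreover from this have "\<phi> integrable_on {a..t}"
      using Henstock_Kurzweil_Integration.integrable_combine[OF a _ _ int, of t] False by simp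
    ultimately show ?thesis
      using Henstock_Kurzweil_Integration.integral_combine[of a 0 t \<phi>] a False by simp
  qed
  then show "\<phi> integrable_on {a..t}" "integral {a..t} \<phi> = integral {0..t} \<phi>"
    by blast+
qed

lemma continuous_primitive:
  fixes \<phi> :: "real \<Rightarrow> real"
  assumes "\<And>r. r \<le> 0 \<Longrightarrow> \<phi> r = 0" "\<And>t. \<phi> integrable_on {0..t}"
  shows "continuous_on UNIV (\<lambda>t. integral {0..t} \<phi>)"
proof -
  note from_0 = integral_from_0[OF assms]
  have "isCont (\<lambda>t. integral {0..t} \<phi>) x" for x
  proof -
    have "continuous_on {- \<bar>x\<bar> - 1..\<bar>x\<bar> + 1} (\<lambda>t. integral {- \<bar>x\<bar> - 1..t} \<phi>)"
      by (rule indefinite_integral_continuous_1, rule from_0(1)) auto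
    then have "continuous_on {- \<bar>x\<bar> - 1<..<\<bar>x\<bar> + 1} (\<lambda>t. integral {- \<bar>x\<bar> - 1..t} \<phi>)"
      by (rule continuous_on_subset) auto
    moreover have "integral {- \<bar>x\<bar> - 1..t} \<phi> = integral {0..t} \<phi>" for t
      by (rule from_0(2)) auto
    ultimately have "continuous_on {- \<bar>x\<bar> - 1<..<\<bar>x\<bar> + 1} (\<lambda>t. integral {0..t} \<phi>)"
      by simp
    then show ?thesis
      by (rule continuous_on_interior) auto
  qed
  then show ?thesis
    by (simp add: continuous_at_imp_continuous_on)
qed

text \<open>With a base point \<open>a < x\<close> every \<open>x\<close> becomes interior, so the
  derivative is two-sided even at 0. The profile thus continues by zero to the left without any
  pasting.\<close>

lemma deriv_primitive:
  fixes \<phi> :: "real \<Rightarrow> real"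
  assumes "\<And>r. r \<le> 0 \<Longrightarrow> \<phi> r = 0" "continuous_on UNIV \<phi>"
  shows "((\<lambda>t. integral {0..t} \<phi>) has_real_derivative \<phi> x) (at x)"
proof -
  have int: "\<phi> integrable_on {0..t}" for t
    by (rule integrable_continuous_real, rule continuous_on_subset[OF assms(2)]) auto
  define a b where "a = - \<bar>x\<bar> - 1" and "b = \<bar>x\<bar> + 1"
  have ab: "a < x" "x < b" "a \<le> 0"
    by (auto simp: a_def b_def)
  have "((\<lambda>t. integral {a..t} \<phi>) has_real_derivative \<phi> x) (at x within {a..b})"
    by (rule integral_has_real_derivative) (use ab assms(2) continuous_on_subset in auto)
  then have "((\<lambda>t. integral {a..t} \<phi>) has_real_derivative \<phi> x) (at x)"
    using ab by (simp add: at_within_Icc_at)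
  moreover have "(\<lambda>t. integral {a..t} \<phi>) = (\<lambda>t. integral {0..t} \<phi>)"
    by (rule ext, rule integral_from_0(2)[OF assms(1) int ab(3)])
  ultimately show ?thesis by simp
qed

text \<open>Variation of constants for \<open>g' = \<phi> - k * g\<close> with
  \<open>g 0 = 0\<close>.\<close>

lemma deriv_exp_primitive:
  fixes \<phi> :: "real \<Rightarrow> real"
  assumes "\<And>r. r \<le> 0 \<Longrightarrow> \<phi> r = 0" "continuous_on UNIV \<phi>"
  shows "((\<lambda>t. exp (- k * t) * integral {0..t} (\<lambda>r. exp (k * r) * \<phi> r)) has_real_derivative
    \<phi> x - k * (exp (- k * x) * integral {0..x} (\<lambda>r. exp (k * r) * \<phi> r))) (at x)"
proof -
  have 1: "((\<lambda>t. integral {0..t} (\<lambda>r. exp (k * r) * \<phi> r)) has_real_derivative exp (k * x) * \<phi> x) (at x)"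
    by (rule deriv_primitive) (use assms in \<open>auto intro!: continuous_intros\<close>)
  have 2: "((\<lambda>y. exp (- k * y)) has_real_derivative exp (- k * x) * (- k)) (at x)"
    by (rule DERIV_fun_exp DERIV_cmult_Id)+
  have "exp (k * x) * exp (- k * x) = 1"
    by (simp flip: exp_add)
  moreover have "exp (k * x) * \<phi> x * exp (- k * x) = exp (k * x) * exp (- k * x) * \<phi> x"
    by (simp only: mult_ac)
  ultimately have *: "exp (k * x) * \<phi> x * exp (- k * x) = \<phi> x"
    by (simp only: mult_1_left)
  from DERIV_mult[OF 2 1] show ?thesis
    unfolding * by (rule DERIV_cong) simp
qed

text \<open>
  With \<open>c = 1\<close>, \<open>\<Lambda> \<omega>'' + \<omega>' = \<omega>\<^sup>\<alpha>\<close> and \<open>\<omega>(0) = \<omega>'(0) = 0\<close> is the fixed point equation of the monotone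
  operator \<open>T\<close> below.  Since \<open>x / (\<Lambda> + L) \<le> 1 - exp (- x / \<Lambda>) \<le> x / \<Lambda>\<close> on \<open>[0, L]\<close>, the barrier with parameter
  \<open>N\<close> is a supersolution for \<open>N = \<Lambda>\<close> and a subsolution on \<open>[0, L]\<close> for \<open>N = \<Lambda> + L\<close>; so the iteration
  started at the supersolution decreases to a nontrivial fixed point.
\<close>

locale profile_construction =
  fixes \<alpha> \<Lambda> :: real
  assumes \<alpha>: "0 < \<alpha>" "\<alpha> < 1" and \<Lambda>: "0 < \<Lambda>"
begin

text \<open>The exponent that balances two derivatives against the power \<open>\<alpha>\<close>:
  \<open>\<beta> - 2 = \<beta> * \<alpha>\<close>.\<close>

definition \<beta> :: real where "\<beta> = 2 / (1 - \<alpha>)"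

text \<open>The solution \<open>A\<close> of
  \<open>N * A * \<beta> * (\<beta> - 1) = A powr \<alpha>\<close>; with it the barrier satisfies
  \<open>N * b'' = b powr \<alpha>\<close> for positive \<open>t\<close>, the equation without
  friction.\<close>

definition amplitude :: "real \<Rightarrow> real" where
  "amplitude N = (1 / (N * (\<beta> * (\<beta> - 1)))) powr (1 / (1 - \<alpha>))"

definition barrier :: "real \<Rightarrow> real \<Rightarrow> real" where
  "barrier N t = amplitude N * max 0 t powr \<beta>"

text \<open>The kernel is the Green function of \<open>\<Lambda> * w'' + w'\<close> with zero value
  and slope at 0.\<close>

definition T :: "(real \<Rightarrow> real) \<Rightarrow> real \<Rightarrow> real" where
  "T f t = integral {0..t} (\<lambda>r. (1 - exp (- (t - r) / \<Lambda>)) * f r powr \<alpha>)"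

definition admissible :: "(real \<Rightarrow> real) \<Rightarrow> bool" where
  "admissible f \<longleftrightarrow> continuous_on UNIV f \<and> (\<forall>t. 0 \<le> f t) \<and> (\<forall>t\<le>0. f t = 0)"

primrec iterate :: "nat \<Rightarrow> real \<Rightarrow> real" where
  "iterate 0 = barrier \<Lambda>"
| "iterate (Suc n) = T (iterate n)"

definition \<omega> :: "real \<Rightarrow> real" where
  "\<omega> t = lim (\<lambda>n. iterate n t)"

lemma \<beta>: "2 < \<beta>" "\<beta> * \<alpha> = \<beta> - 2"
  using \<alpha> by (auto simp: \<beta>_def field_simps)

lemma amplitude_pos: "0 < N \<Longrightarrow> 0 < amplitude N"
  using \<beta> by (simp add: amplitude_def)

lemma amplitude_antimono: "0 < M \<Longrightarrow> M \<le> N \<Longrightarrow> amplitude N \<le> amplitude M"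
  unfolding amplitude_def using \<alpha> \<beta>
  by (intro powr_mono2 divide_left_mono mult_right_mono) (auto intro!: mult_pos_pos)

lemma amplitude_powr: "amplitude N powr \<alpha> / (\<beta> * (\<beta> - 1)) = N * amplitude N" if "0 < N"
proof -
  define q where "q = 1 / (N * (\<beta> * (\<beta> - 1)))"
  have q: "0 < q"
    using that \<beta> by (simp add: q_def)
  have "1 / (1 - \<alpha>) * \<alpha> = 1 / (1 - \<alpha>) - 1"
    using \<alpha> by (simp add: field_simps)
  then have "amplitude N powr \<alpha> = q powr (1 / (1 - \<alpha>)) / q"
    unfolding amplitude_def q_def[symmetric] powr_powr using q by (simp add: powr_diff)
  then show ?thesis
    unfolding amplitude_def q_def[symmetric] using that \<beta> by (simp add: q_def)
qed

text \<open>The frictionless equation in integrated form: \<open>t - r\<close> is the Green function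
  of the second derivative.\<close>

lemma has_integral_barrier:
  assumes "0 < N" "0 \<le> t"
  shows "((\<lambda>r. (t - r) * barrier N r powr \<alpha>) has_integral N * barrier N t) {0..t}"
proof -
  have 1: "((\<lambda>r. r powr (\<beta> - 2)) has_integral t powr (\<beta> - 2 + 1) / (\<beta> - 2 + 1)) {0..t}"
    and 2: "((\<lambda>r. r powr (\<beta> - 1)) has_integral t powr (\<beta> - 1 + 1) / (\<beta> - 1 + 1)) {0..t}"
    using \<beta> assms by (intro has_integral_powr_from_0; simp)+
  have t: "t powr (\<beta> - 1) * t = t powr \<beta>"
  proof (cases "t = 0")
    case False
    then have "t powr (\<beta> - 1) * t powr 1 = t powr \<beta>"
      unfolding powr_add[symmetric] by simp
    then show ?thesis using assms False by simp
  qed (use \<beta> in simp)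
  have eq: "(t - r) * barrier N r powr \<alpha> = amplitude N powr \<alpha> * (t * r powr (\<beta> - 2) - r powr (\<beta> - 1))"
    if "r \<in> {0..t}" for r
  proof (cases "r = 0")
    case False
    then have "r powr (\<beta> - 2) * r powr 1 = r powr (\<beta> - 1)"
      unfolding powr_add[symmetric] by simp
    then have "r powr (\<beta> - 2) * r = r powr (\<beta> - 1)"
      using that by simp
    moreover have "barrier N r powr \<alpha> = amplitude N powr \<alpha> * r powr (\<beta> - 2)"
      using that amplitude_pos[OF assms(1)] \<beta> by (simp add: barrier_def powr_mult powr_powr)
    ultimately show ?thesis
      by (simp add: algebra_simps)
  qed (use \<beta> \<alpha> in \<open>simp add: barrier_def\<close>)
  have "((\<lambda>r. amplitude N powr \<alpha> * (t * r powr (\<beta> - 2) - r powr (\<beta> - 1))) has_integral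
      amplitude N powr \<alpha> * (t * (t powr (\<beta> - 2 + 1) / (\<beta> - 2 + 1)) - t powr (\<beta> - 1 + 1) / (\<beta> - 1 + 1))) {0..t}"
    by (intro has_integral_mult_right has_integral_diff 1 2)
  moreover have "t * (t powr (\<beta> - 2 + 1) / (\<beta> - 2 + 1)) - t powr (\<beta> - 1 + 1) / (\<beta> - 1 + 1)
      = t powr \<beta> / (\<beta> * (\<beta> - 1))"
  proof -
    have "t * (t powr (\<beta> - 2 + 1) / (\<beta> - 2 + 1)) = t powr \<beta> / (\<beta> - 1)"
      using t by (simp add: mult.commute)
    then show ?thesis
      using \<beta> by (simp add: field_simps)
  qed
  moreover have "amplitude N powr \<alpha> * (t powr \<beta> / (\<beta> * (\<beta> - 1)))
      = amplitude N powr \<alpha> / (\<beta> * (\<beta> - 1)) * t powr \<beta>"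
    by simp
  then have "amplitude N powr \<alpha> * (t powr \<beta> / (\<beta> * (\<beta> - 1))) = N * barrier N t"
    unfolding amplitude_powr[OF assms(1)] using assms(2) by (simp add: barrier_def)
  ultimately show ?thesis
    using has_integral_cong[of "{0..t}", OF eq] by simp
qed

lemma kernel_le: "1 - exp (- x / \<Lambda>) \<le> x / \<Lambda>"
  using exp_ge_add_one_self[of "- x / \<Lambda>"] by simp

lemma kernel_nonneg: "0 \<le> x \<Longrightarrow> 0 \<le> 1 - exp (- x / \<Lambda>)"
  using \<Lambda> by simp

lemma kernel_ge: "x / (\<Lambda> + L) \<le> 1 - exp (- x / \<Lambda>)" if "0 \<le> x" "x \<le> L"
proof -
  have "x / (\<Lambda> + L) \<le> x / (\<Lambda> + x)"
    using \<Lambda> that by (intro divide_left_mono) auto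
  also have "\<dots> = 1 - 1 / (1 + x / \<Lambda>)"
    using \<Lambda> that by (simp add: field_simps)
  also have "1 / (1 + x / \<Lambda>) \<ge> 1 / exp (x / \<Lambda>)"
    using exp_ge_add_one_self[of "x / \<Lambda>"] \<Lambda> that by (intro divide_left_mono) (auto intro!: mult_pos_pos add_pos_nonneg)
  then have "1 - 1 / (1 + x / \<Lambda>) \<le> 1 - exp (- x / \<Lambda>)"
    by (simp add: exp_minus inverse_eq_divide)
  finally show ?thesis .
qed

lemma admissible_barrier: "0 < N \<Longrightarrow> admissible (barrier N)"
  using amplitude_pos[of N] \<beta> unfolding admissible_def barrier_def
  by (auto intro!: continuous_intros continuous_on_powr')

lemma cont_powr: "continuous_on S (\<lambda>r. f r powr \<alpha>)" if "admissible f"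
  by (rule continuous_on_powr') (use that \<alpha> continuous_on_subset in \<open>auto simp: admissible_def\<close>)

lemma T_integrable: "(\<lambda>r. (1 - exp (- (t - r) / \<Lambda>)) * f r powr \<alpha>) integrable_on {0..t}" if "admissible f"
  using \<Lambda> that by (intro integrable_continuous_real continuous_intros cont_powr) auto

lemma T_mono: "T f t \<le> T h t"
  if "admissible f" "admissible h" "\<And>r. 0 \<le> r \<Longrightarrow> r \<le> t \<Longrightarrow> f r \<le> h r"
  unfolding T_def
proof (rule integral_le)
  fix r assume "r \<in> {0..t}"
  then have "f r powr \<alpha> \<le> h r powr \<alpha>" "0 \<le> 1 - exp (- (t - r) / \<Lambda>)"
    using that \<alpha> kernel_nonneg[of "t - r"] by (auto intro!: powr_mono2 simp: admissible_def)
  then show "(1 - exp (- (t - r) / \<Lambda>)) * f r powr \<alpha> \<le> (1 - exp (- (t - r) / \<Lambda>)) * h r powr \<alpha>"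
    by (rule mult_left_mono)
qed (use that T_integrable in auto)

text \<open>The exponential splits into a factor in \<open>t\<close> and one in \<open>r\<close>, so
  \<open>T\<close> is assembled from two primitives and inherits their regularity.\<close>

lemma integral_kernel:
  fixes \<phi> :: "real \<Rightarrow> real"
  assumes "\<phi> integrable_on {0..t}" "(\<lambda>r. exp (1 / \<Lambda> * r) * \<phi> r) integrable_on {0..t}"
  shows "integral {0..t} (\<lambda>r. (1 - exp (- (t - r) / \<Lambda>)) * \<phi> r)
    = integral {0..t} \<phi> - exp (- (1 / \<Lambda>) * t) * integral {0..t} (\<lambda>r. exp (1 / \<Lambda> * r) * \<phi> r)"
proof -
  have "((\<lambda>r. \<phi> r - exp (- (1 / \<Lambda>) * t) * (exp (1 / \<Lambda> * r) * \<phi> r)) has_integral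
      integral {0..t} \<phi> - exp (- (1 / \<Lambda>) * t) * integral {0..t} (\<lambda>r. exp (1 / \<Lambda> * r) * \<phi> r)) {0..t}"
    by (intro has_integral_diff has_integral_mult_right integrable_integral assms)
  moreover have "\<phi> r - exp (- (1 / \<Lambda>) * t) * (exp (1 / \<Lambda> * r) * \<phi> r) = (1 - exp (- (t - r) / \<Lambda>)) * \<phi> r" for r
  proof -
    have "exp (- (t - r) / \<Lambda>) = exp (- (1 / \<Lambda>) * t) * exp (1 / \<Lambda> * r)"
      by (simp add: diff_divide_distrib flip: exp_add)
    then show ?thesis
      by (simp add: algebra_simps)
  qed
  ultimately show ?thesis
    by (simp add: integral_unique)
qed

text \<open>Only integrability is required, so that it also applies to the limit of the iterates
  before its continuity is known.\<close>

lemma continuous_kernel_primitive: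
  fixes \<phi> :: "real \<Rightarrow> real"
  assumes zero: "\<And>r. r \<le> 0 \<Longrightarrow> \<phi> r = 0"
    and int: "\<And>t. \<phi> integrable_on {0..t}" "\<And>t. (\<lambda>r. exp (1 / \<Lambda> * r) * \<phi> r) integrable_on {0..t}"
  shows "continuous_on UNIV (\<lambda>t. integral {0..t} \<phi> -
    exp (- (1 / \<Lambda>) * t) * integral {0..t} (\<lambda>r. exp (1 / \<Lambda> * r) * \<phi> r))"
proof (rule continuous_on_diff[OF continuous_primitive[OF zero int(1)]
      continuous_on_mult[OF _ continuous_primitive[OF _ int(2)]]])
  show "continuous_on UNIV (\<lambda>t. exp (- (1 / \<Lambda>) * t))"
    by (intro continuous_on_exp continuous_on_mult continuous_on_const continuous_on_id)
qed (simp_all add: zero)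

lemma admissible_T: "admissible (T f)" if f: "admissible f"
proof -
  let ?\<phi> = "\<lambda>r. f r powr \<alpha>"
  have int: "?\<phi> integrable_on {0..t}" "(\<lambda>r. exp (1 / \<Lambda> * r) * ?\<phi> r) integrable_on {0..t}" for t
    using f by (intro integrable_continuous_real continuous_intros cont_powr; simp)+
  have zero: "?\<phi> r = 0" if "r \<le> 0" for r
    using f that by (simp add: admissible_def)
  have "continuous_on UNIV (\<lambda>t. integral {0..t} ?\<phi> -
      exp (- (1 / \<Lambda>) * t) * integral {0..t} (\<lambda>r. exp (1 / \<Lambda> * r) * ?\<phi> r))"
    by (rule continuous_kernel_primitive[of "\<lambda>r. f r powr \<alpha>", OF zero int])
  moreover have "T f = (\<lambda>t. integral {0..t} ?\<phi> -
      exp (- (1 / \<Lambda>) * t) * integral {0..t} (\<lambda>r. exp (1 / \<Lambda> * r) * ?\<phi> r))"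
    unfolding T_def by (rule ext, rule integral_kernel[where \<phi> = ?\<phi>, OF int])
  ultimately have "continuous_on UNIV (T f)"
    by (simp only:)
  moreover have "0 \<le> T f t" for t
    unfolding T_def by (rule integral_nonneg[OF T_integrable[OF f]]) (intro mult_nonneg_nonneg kernel_nonneg; simp)
  moreover have "T f t = 0" if "t \<le> 0" for t
    unfolding T_def by (rule integral_unique, rule has_integral_is_0) (use that zero in auto)
  ultimately show ?thesis
    by (simp add: admissible_def)
qed

lemma T_barrier_le: "T (barrier \<Lambda>) t \<le> barrier \<Lambda> t"
proof (cases "0 \<le> t")
  case True
  have "T (barrier \<Lambda>) t \<le> 1 / \<Lambda> * (\<Lambda> * barrier \<Lambda> t)"
    unfolding T_def
  proof (rule has_integral_le)
    show "((\<lambda>r. (1 - exp (- (t - r) / \<Lambda>)) * barrier \<Lambda> r powr \<alpha>) has_integral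
        integral {0..t} (\<lambda>r. (1 - exp (- (t - r) / \<Lambda>)) * barrier \<Lambda> r powr \<alpha>)) {0..t}"
      using T_integrable admissible_barrier \<Lambda> by (intro integrable_integral) auto
    show "((\<lambda>r. 1 / \<Lambda> * ((t - r) * barrier \<Lambda> r powr \<alpha>)) has_integral 1 / \<Lambda> * (\<Lambda> * barrier \<Lambda> t)) {0..t}"
      by (rule has_integral_mult_right[OF has_integral_barrier[OF \<Lambda> True]])
    show "(1 - exp (- (t - r) / \<Lambda>)) * barrier \<Lambda> r powr \<alpha> \<le> 1 / \<Lambda> * ((t - r) * barrier \<Lambda> r powr \<alpha>)" for r
      using mult_right_mono[OF kernel_le[of "t - r"], of "barrier \<Lambda> r powr \<alpha>"] by simp
  qed
  then show ?thesis using \<Lambda> by simp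
next
  case False
  then show ?thesis
    using admissible_T[OF admissible_barrier[OF \<Lambda>]] admissible_barrier[OF \<Lambda>]
    by (simp add: admissible_def)
qed

lemma T_barrier_ge: "barrier (\<Lambda> + L) t \<le> T (barrier (\<Lambda> + L)) t" if "0 \<le> t" "t \<le> L"
proof -
  have N: "0 < \<Lambda> + L"
    using \<Lambda> that by simp
  have "1 / (\<Lambda> + L) * ((\<Lambda> + L) * barrier (\<Lambda> + L) t) \<le> T (barrier (\<Lambda> + L)) t"
    unfolding T_def
  proof (rule has_integral_le)
    show "((\<lambda>r. (1 - exp (- (t - r) / \<Lambda>)) * barrier (\<Lambda> + L) r powr \<alpha>) has_integral
        integral {0..t} (\<lambda>r. (1 - exp (- (t - r) / \<Lambda>)) * barrier (\<Lambda> + L) r powr \<alpha>)) {0..t}"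
      using T_integrable admissible_barrier[OF N] by (intro integrable_integral) auto
    show "((\<lambda>r. 1 / (\<Lambda> + L) * ((t - r) * barrier (\<Lambda> + L) r powr \<alpha>)) has_integral
        1 / (\<Lambda> + L) * ((\<Lambda> + L) * barrier (\<Lambda> + L) t)) {0..t}"
      by (rule has_integral_mult_right[OF has_integral_barrier[OF N that(1)]])
    fix r assume "r \<in> {0..t}"
    then show "1 / (\<Lambda> + L) * ((t - r) * barrier (\<Lambda> + L) r powr \<alpha>)
        \<le> (1 - exp (- (t - r) / \<Lambda>)) * barrier (\<Lambda> + L) r powr \<alpha>"
      using mult_right_mono[OF kernel_ge[of "t - r" L], of "barrier (\<Lambda> + L) r powr \<alpha>"] that by simp
  qed
  then show ?thesis using N by simp
qed

lemma admissible_iterate: "admissible (iterate n)"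
  by (induction n) (use admissible_barrier admissible_T \<Lambda> in auto)

lemma iterate_decreasing: "iterate (Suc n) t \<le> iterate n t"
proof (induction n arbitrary: t)
  case 0
  show ?case using T_barrier_le by simp
next
  case (Suc n)
  have "T (iterate (Suc n)) t \<le> T (iterate n) t"
    by (rule T_mono[OF admissible_iterate admissible_iterate Suc.IH])
  then show ?case by simp
qed

text \<open>\<open>L\<close> is a fixed horizon. Since \<open>T\<close> looks at all of
  \<open>[0, t]\<close>, the induction ranges over every \<open>t\<close> up to it; the start holds
  because the amplitude decreases in its parameter.\<close>

lemma iterate_ge: "0 \<le> t \<Longrightarrow> t \<le> L \<Longrightarrow> barrier (\<Lambda> + L) t \<le> iterate n t"
proof (induction n arbitrary: t)
  case 0
  then show ?case
    using amplitude_antimono[of \<Lambda> "\<Lambda> + L"] \<Lambda> by (auto simp: barrier_def intro!: mult_right_mono)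
next
  case (Suc n)
  have N: "0 < \<Lambda> + L"
    using \<Lambda> Suc.prems by simp
  have "barrier (\<Lambda> + L) t \<le> T (barrier (\<Lambda> + L)) t"
    using Suc.prems by (rule T_barrier_ge)
  also have "\<dots> \<le> T (iterate n) t"
    by (rule T_mono[OF admissible_barrier[OF N] admissible_iterate]) (use Suc in auto)
  finally show ?case by simp
qed

lemma iterate_le: "iterate n t \<le> barrier \<Lambda> t"
proof (induction n)
  case (Suc n)
  show ?case
    by (rule order_trans[OF iterate_decreasing Suc.IH])
qed simp

lemma iterate_nonneg: "0 \<le> iterate n t"
  using admissible_iterate by (simp add: admissible_def)

lemma tendsto_\<omega>: "(\<lambda>n. iterate n t) \<longlonglongrightarrow> \<omega> t"
proof -
  have dec: "decseq (\<lambda>n. iterate n t)"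
    by (rule decseq_SucI, rule iterate_decreasing)
  have "\<forall>n. 0 \<le> iterate n t"
    by (intro allI iterate_nonneg)
  from decseq_convergent[OF dec this] obtain l where "(\<lambda>n. iterate n t) \<longlonglongrightarrow> l"
    by metis
  then show ?thesis
    unfolding \<omega>_def by (simp add: limI)
qed

lemma \<omega>_nonneg: "0 \<le> \<omega> t"
  by (rule LIMSEQ_le_const[OF tendsto_\<omega>]) (use iterate_nonneg in auto)

lemma \<omega>_left: "t \<le> 0 \<Longrightarrow> \<omega> t = 0"
proof -
  assume "t \<le> 0"
  then have "iterate n t = 0" for n
    using admissible_iterate by (simp add: admissible_def)
  then show ?thesis
    using tendsto_\<omega>[of t] by (simp add: LIMSEQ_const_iff)
qed

text \<open>The lower barrier depends on the horizon, but each \<open>t\<close> may take itself as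
  horizon.\<close>

lemma \<omega>_pos: "0 < \<omega> t" if "0 < t"
proof -
  have "barrier (\<Lambda> + t) t \<le> \<omega> t"
    by (rule LIMSEQ_le_const[OF tendsto_\<omega>]) (use iterate_ge that in auto)
  moreover have "0 < barrier (\<Lambda> + t) t"
    using amplitude_pos[of "\<Lambda> + t"] \<Lambda> that by (simp add: barrier_def)
  ultimately show ?thesis by linarith
qed

text \<open>The weight is left general to cover the constant 1, the growing exponential and the
  kernel of \<open>T\<close>; the supersolution dominates all iterates.\<close>

lemma dominated:
  assumes \<kappa>: "continuous_on {0..t} \<kappa>"
  shows "(\<lambda>r. \<kappa> r * \<omega> r powr \<alpha>) integrable_on {0..t}"
    and "(\<lambda>n. integral {0..t} (\<lambda>r. \<kappa> r * iterate n r powr \<alpha>)) \<longlonglongrightarrow> integral {0..t} (\<lambda>r. \<kappa> r * \<omega> r powr \<alpha>)"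
proof -
  have 1: "(\<lambda>r. \<kappa> r * iterate n r powr \<alpha>) integrable_on {0..t}" for n
    by (intro integrable_continuous_real continuous_intros \<kappa> cont_powr admissible_iterate)
  have 2: "(\<lambda>r. \<bar>\<kappa> r\<bar> * barrier \<Lambda> r powr \<alpha>) integrable_on {0..t}"
    by (intro integrable_continuous_real continuous_intros \<kappa> cont_powr admissible_barrier \<Lambda>)
  have 3: "norm (\<kappa> r * iterate n r powr \<alpha>) \<le> \<bar>\<kappa> r\<bar> * barrier \<Lambda> r powr \<alpha>" for n r
    using iterate_le iterate_nonneg \<alpha> by (auto simp: abs_mult intro!: mult_left_mono powr_mono2)
  have 4: "(\<lambda>n. \<kappa> r * iterate n r powr \<alpha>) \<longlonglongrightarrow> \<kappa> r * \<omega> r powr \<alpha>" for r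
    by (rule tendsto_mult_left, rule tendsto_powr'[OF tendsto_\<omega> tendsto_const])
      (use \<alpha> iterate_nonneg in auto)
  show "(\<lambda>r. \<kappa> r * \<omega> r powr \<alpha>) integrable_on {0..t}"
    and "(\<lambda>n. integral {0..t} (\<lambda>r. \<kappa> r * iterate n r powr \<alpha>)) \<longlonglongrightarrow> integral {0..t} (\<lambda>r. \<kappa> r * \<omega> r powr \<alpha>)"
    using dominated_convergence[of "\<lambda>n r. \<kappa> r * iterate n r powr \<alpha>" "{0..t}"
        "\<lambda>r. \<bar>\<kappa> r\<bar> * barrier \<Lambda> r powr \<alpha>" "\<lambda>r. \<kappa> r * \<omega> r powr \<alpha>", OF 1 2 3 4] by auto
qed

lemma \<omega>_fixed_point: "\<omega> = T \<omega>"
proof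
  fix t
  have "continuous_on {0..t} (\<lambda>r. 1 - exp (- (t - r) / \<Lambda>))"
    using \<Lambda> by (intro continuous_intros) auto
  from dominated(2)[OF this] have "(\<lambda>n. iterate (Suc n) t) \<longlonglongrightarrow> T \<omega> t"
    by (simp add: T_def)
  moreover have "(\<lambda>n. iterate (Suc n) t) \<longlonglongrightarrow> \<omega> t"
    by (rule LIMSEQ_Suc[OF tendsto_\<omega>])
  ultimately show "\<omega> t = T \<omega> t"
    using LIMSEQ_unique by blast
qed

text \<open>After rescaling, the unweighted flux integral.\<close>

definition F :: "real \<Rightarrow> real" where
  "F t = integral {0..t} (\<lambda>r. \<omega> r powr \<alpha>)"

text \<open>After rescaling, the flux integral with weight \<open>exp (- (t - r))\<close>; the two
  flux conditions amount to \<open>G \<rho> = \<theta> * F \<rho>\<close>. The factors 1 match the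
  form of \<open>deriv_exp_primitive\<close>.\<close>

definition G :: "real \<Rightarrow> real" where
  "G t = exp (- 1 * t) * integral {0..t} (\<lambda>r. exp (1 * r) * \<omega> r powr \<alpha>)"

lemma integrable_\<omega>:
  "(\<lambda>r. \<omega> r powr \<alpha>) integrable_on {0..t}"
  "(\<lambda>r. exp (1 / \<Lambda> * r) * \<omega> r powr \<alpha>) integrable_on {0..t}"
proof -
  show "(\<lambda>r. \<omega> r powr \<alpha>) integrable_on {0..t}"
    using dominated(1)[OF continuous_on_const[of _ 1], of t] by simp
  show "(\<lambda>r. exp (1 / \<Lambda> * r) * \<omega> r powr \<alpha>) integrable_on {0..t}"
    by (intro dominated(1) continuous_on_exp continuous_on_mult continuous_on_const continuous_on_id)
qed

lemma \<omega>_eq: "\<omega> t = F t - exp (- (1 / \<Lambda>) * t) * integral {0..t} (\<lambda>r. exp (1 / \<Lambda> * r) * \<omega> r powr \<alpha>)"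
proof (rule trans[OF fun_cong[OF \<omega>_fixed_point]])
  show "T \<omega> t = F t - exp (- (1 / \<Lambda>) * t) * integral {0..t} (\<lambda>r. exp (1 / \<Lambda> * r) * \<omega> r powr \<alpha>)"
    unfolding T_def F_def by (rule integral_kernel[where \<phi> = "\<lambda>r. \<omega> r powr \<alpha>", OF integrable_\<omega>])
qed

text \<open>A bootstrap: the limit is so far only known to be integrable, and the fixed point
  equation writes it through primitives, which are continuous.\<close>

lemma cont_\<omega>_powr: "continuous_on UNIV (\<lambda>r. \<omega> r powr \<alpha>)"
proof (rule continuous_on_powr')
  have zero: "\<omega> r powr \<alpha> = 0" if "r \<le> 0" for r
    using \<omega>_left[OF that] by simp
  have "continuous_on UNIV (\<lambda>t. F t - exp (- (1 / \<Lambda>) * t) * integral {0..t} (\<lambda>r. exp (1 / \<Lambda> * r) * \<omega> r powr \<alpha>))"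
    unfolding F_def by (rule continuous_kernel_primitive[of "\<lambda>r. \<omega> r powr \<alpha>", OF zero integrable_\<omega>])
  moreover have "\<omega> = (\<lambda>t. F t - exp (- (1 / \<Lambda>) * t) * integral {0..t} (\<lambda>r. exp (1 / \<Lambda> * r) * \<omega> r powr \<alpha>))"
    by (rule ext, rule \<omega>_eq)
  ultimately show "continuous_on UNIV \<omega>"
    by (rule ssubst[where P = "continuous_on UNIV", rotated])
qed (use \<alpha> \<omega>_nonneg in auto)

lemma \<omega>_powr_left: "r \<le> 0 \<Longrightarrow> \<omega> r powr \<alpha> = 0"
  using \<omega>_left by simp

lemma deriv_F: "(F has_real_derivative \<omega> t powr \<alpha>) (at t)"
  unfolding F_def[abs_def] by (rule deriv_primitive[OF \<omega>_powr_left cont_\<omega>_powr])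

lemma deriv_G: "(G has_real_derivative \<omega> t powr \<alpha> - G t) (at t)"
  using deriv_exp_primitive[OF \<omega>_powr_left cont_\<omega>_powr, of 1 t]
  unfolding G_def[abs_def] by simp

text \<open>The first integral \<open>\<Lambda> * \<omega>' + \<omega> = F\<close> of the second
  order equation.\<close>

lemma deriv_\<omega>: "(\<omega> has_real_derivative (F t - \<omega> t) / \<Lambda>) (at t)"
proof -
  have E: "exp (- (1 / \<Lambda>) * t) * integral {0..t} (\<lambda>r. exp (1 / \<Lambda> * r) * \<omega> r powr \<alpha>) = F t - \<omega> t" for t
    using \<omega>_eq[of t] by linarith
  from DERIV_diff[OF deriv_F deriv_exp_primitive[OF \<omega>_powr_left cont_\<omega>_powr, of "1 / \<Lambda>" t]]
  show ?thesis
    unfolding E by simp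
qed

lemma F_left: "t \<le> 0 \<Longrightarrow> F t = 0" and G_left: "t \<le> 0 \<Longrightarrow> G t = 0"
proof -
  assume "t \<le> 0"
  have "integral {0..t} (\<lambda>r. h r * \<omega> r powr \<alpha>) = 0" for h :: "real \<Rightarrow> real"
    by (rule integral_unique, rule has_integral_is_0) (use \<omega>_left \<open>t \<le> 0\<close> in auto)
  from this[of "\<lambda>_. 1"] this[of "\<lambda>r. exp (1 * r)"] show "F t = 0" "G t = 0"
    by (simp_all add: F_def G_def)
qed

end

section \<open>Existence of travelling waves\<close>

lemma deriv_paste:
  fixes f g :: "real \<Rightarrow> real"
  assumes f: "\<And>x. (f has_real_derivative f' x) (at x)"
    and g: "\<And>x. (g has_real_derivative g' x) (at x)"
    and eq: "f a = g a" "f' a = g' a"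
  shows "((\<lambda>x. if x \<le> a then f x else g x) has_real_derivative (if x \<le> a then f' x else g' x)) (at x)"
proof -
  consider "x < a" | "x = a" | "a < x" by linarith
  then show ?thesis
  proof cases
    case 1
    have "((\<lambda>x. if x \<le> a then f x else g x) has_real_derivative f' x) (at x)"
      by (rule has_field_derivative_transform_within_open[OF f, of "{..<a}"]) (use 1 in auto)
    then show ?thesis using 1 by simp
  next
    case 2
    let ?h = "\<lambda>x. if x \<le> a then f x else g x"
    have "(?h has_real_derivative f' a) (at a within {..a})"
      by (rule has_field_derivative_transform_within[OF has_field_derivative_at_within[OF f], of 1]) auto
    then have left: "((\<lambda>y. (?h y - ?h a) / (y - a)) \<longlongrightarrow> f' a) (at a within {..a})"
      unfolding has_field_derivative_iff .
    have "(?h has_real_derivative f' a) (at a within {a..})"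
      unfolding eq(2)
      by (rule has_field_derivative_transform_within[OF has_field_derivative_at_within[OF g], of 1])
        (use eq in auto)
    then have right: "((\<lambda>y. (?h y - ?h a) / (y - a)) \<longlongrightarrow> f' a) (at a within {a..})"
      unfolding has_field_derivative_iff .
    have UNIV: "{..a} \<union> {a..} = UNIV" by auto
    have "(?h has_real_derivative f' a) (at a)"
      unfolding has_field_derivative_iff
      using filterlim_sup[OF left right] unfolding at_within_union[symmetric] UNIV .
    then show ?thesis using 2 by simp
  next
    case 3
    have "((\<lambda>x. if x \<le> a then f x else g x) has_real_derivative g' x) (at x)"
      by (rule has_field_derivative_transform_within_open[OF g, of "{a<..}"]) (use 3 in auto)
    then show ?thesis using 3 by simp
  qed
qed

lemma continuous_paste:
  fixes f g :: "real \<Rightarrow> real"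
  assumes "continuous_on UNIV f" "continuous_on UNIV g" "f a = g a"
  shows "continuous_on UNIV (\<lambda>x. if x \<le> a then f x else g x)"
  by (rule continuous_on_cases_le[OF continuous_on_subset[OF assms(1)] continuous_on_subset[OF assms(2)]
        continuous_on_id]) (use assms(3) in auto)

text \<open>A class closed under differentiation yields a derivative operator by choice, and its
  iterates form the required sequence. The function \<open>k\<close> need only agree with a member
  of the class on \<open>S\<close>, as suits one defined piecewise.\<close>

lemma infinitely_differentiable_onI:
  assumes "P h" and step: "\<And>f. P f \<Longrightarrow> \<exists>g. P g \<and> (\<forall>x\<in>S. (f has_real_derivative g x) (at x within S))"
    and eq: "\<And>x. x \<in> S \<Longrightarrow> h x = k x"
  shows "infinitely_differentiable_on k S"
proof -
  define d where "d f = (SOME g. P g \<and> (\<forall>x\<in>S. (f has_real_derivative g x) (at x within S)))" for f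
  have d: "P (d f) \<and> (\<forall>x\<in>S. (f has_real_derivative d f x) (at x within S))" if "P f" for f
    unfolding d_def by (rule someI_ex[OF step[OF that]])
  define D where "D n = (d ^^ n) h" for n
  have D_Suc: "D (Suc n) = d (D n)" for n
    by (simp add: D_def)
  have P: "P (D n)" for n
  proof (induction n)
    case 0
    show ?case using \<open>P h\<close> by (simp add: D_def)
  next
    case (Suc n)
    show ?case unfolding D_Suc using d[OF Suc] by blast
  qed
  have "\<forall>n. \<forall>x\<in>S. (D n has_real_derivative D (Suc n) x) (at x within S)"
    unfolding D_Suc using d[OF P] by blast
  moreover have "\<forall>x\<in>S. D 0 x = k x"
    using eq by (simp add: D_def)
  ultimately show ?thesis
    unfolding infinitely_differentiable_on_def by blast
qed

lemma ode_atI: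
  assumes w: "\<And>x. (w has_real_derivative w' x) (at x)" and w': "(w' has_real_derivative w'') (at x)"
    and "\<kappa> * w'' - c * w' x = q"
  shows "ode_at \<kappa> c w q x"
proof -
  have "deriv w = w'"
    using w by (intro ext DERIV_imp_deriv)
  moreover have "w differentiable (at z)" for z
    using w real_differentiable_def by blast
  moreover have "w' differentiable (at x)"
    using w' real_differentiable_def by blast
  ultimately show ?thesis
    using assms DERIV_imp_deriv[OF w'] by (simp add: ode_at_def twice_differentiable_at_def)
qed

section \<open>Growth of the profile, the matching point, and smoothness\<close>

context profile_construction
begin

lemma F_pos: "0 < F t" if "0 < t"
proof -
  have "F 0 < F t"
  proof (rule DERIV_pos_imp_increasing_open[OF that])
    show "\<exists>y. (F has_real_derivative y) (at x) \<and> 0 < y" if "0 < x" "x < t" for x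
      using deriv_F[of x] \<omega>_pos[OF that(1)] by (intro exI[of _ "\<omega> x powr \<alpha>"]) simp
  qed (rule DERIV_continuous_on[OF has_field_derivative_at_within[OF deriv_F]])
  then show ?thesis by (simp add: F_left)
qed

lemma \<omega>_le_F: "\<omega> t \<le> F t"
proof -
  have "0 \<le> integral {0..t} (\<lambda>r. exp (1 / \<Lambda> * r) * \<omega> r powr \<alpha>)"
    by (rule integral_nonneg[OF integrable_\<omega>(2)]) simp
  then have "0 \<le> exp (- (1 / \<Lambda>) * t) * integral {0..t} (\<lambda>r. exp (1 / \<Lambda> * r) * \<omega> r powr \<alpha>)"
    by simp
  then show ?thesis
    using \<omega>_eq[of t] by linarith
qed

lemmas cont_F = DERIV_continuous_on[OF has_field_derivative_at_within[OF deriv_F]]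
  and cont_G = DERIV_continuous_on[OF has_field_derivative_at_within[OF deriv_G]]
  and cont_\<omega> = DERIV_continuous_on[OF has_field_derivative_at_within[OF deriv_\<omega>]]

lemma \<omega>_mono: "s \<le> t \<Longrightarrow> \<omega> s \<le> \<omega> t"
  by (rule mono_from_deriv[OF _ cont_\<omega> deriv_\<omega>]) (use \<omega>_le_F \<Lambda> in auto)

lemma \<omega>_powr_mono: "s \<le> t \<Longrightarrow> \<omega> s powr \<alpha> \<le> \<omega> t powr \<alpha>"
  using \<omega>_mono \<omega>_nonneg \<alpha> by (intro powr_mono2) auto

text \<open>\<open>G\<close> relaxes towards \<open>\<omega> powr \<alpha>\<close> by
  \<open>deriv_G\<close>; as this target increases, \<open>G\<close> never overtakes it.\<close>

lemma G_le: "G t \<le> \<omega> t powr \<alpha>" if "0 \<le> t"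
proof -
  let ?K = "\<omega> t powr \<alpha>"
  have "exp t * (G t - ?K) \<le> exp 0 * (G 0 - ?K)"
  proof (rule antimono_from_deriv[where f = "\<lambda>s. exp s * (G s - ?K)" and f' = "\<lambda>s. exp s * (\<omega> s powr \<alpha> - ?K)"])
    show "continuous_on {0..t} (\<lambda>s. exp s * (G s - ?K))"
      by (intro continuous_intros cont_G)
    fix s assume "0 < s" "s < t"
    from DERIV_mult[OF DERIV_exp[of s] DERIV_diff[OF deriv_G[of s] DERIV_const[of ?K]]]
    show "((\<lambda>s. exp s * (G s - ?K)) has_real_derivative exp s * (\<omega> s powr \<alpha> - ?K)) (at s)"
      by (rule DERIV_cong) (simp add: algebra_simps)
    show "exp s * (\<omega> s powr \<alpha> - ?K) \<le> 0"
      using \<omega>_powr_mono[of s t] \<open>s < t\<close> by (simp add: mult_le_0_iff)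
  qed (use that in auto)
  also have "\<dots> \<le> 0"
    by (simp add: G_left)
  finally show ?thesis
    by (simp add: mult_le_0_iff)
qed

lemma G_ge: "exp (- t) * F t \<le> G t" if "0 \<le> t"
proof -
  have "exp 0 * G 0 - F 0 \<le> exp t * G t - F t"
  proof (rule mono_from_deriv[where f = "\<lambda>s. exp s * G s - F s" and f' = "\<lambda>s. exp s * \<omega> s powr \<alpha> - \<omega> s powr \<alpha>"])
    show "continuous_on {0..t} (\<lambda>s. exp s * G s - F s)"
      by (intro continuous_intros cont_G cont_F)
    fix s assume s: "0 < s" "s < t"
    from DERIV_diff[OF DERIV_mult[OF DERIV_exp[of s] deriv_G[of s]] deriv_F[of s]]
    show "((\<lambda>s. exp s * G s - F s) has_real_derivative exp s * \<omega> s powr \<alpha> - \<omega> s powr \<alpha>) (at s)"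
      by (rule DERIV_cong) (simp add: algebra_simps)
    have "1 * \<omega> s powr \<alpha> \<le> exp s * \<omega> s powr \<alpha>"
      using s by (intro mult_right_mono) auto
    then show "0 \<le> exp s * \<omega> s powr \<alpha> - \<omega> s powr \<alpha>" by simp
  qed (use that in auto)
  then have "F t \<le> exp t * G t"
    by (simp add: G_left F_left)
  then have "exp (- t) * F t \<le> exp (- t) * (exp t * G t)"
    by (intro mult_left_mono) auto
  also have "\<dots> = (exp (- t) * exp t) * G t"
    by (simp only: mult.assoc)
  also have "exp (- t) * exp t = 1"
    by (simp flip: exp_add)
  finally show ?thesis by simp
qed

lemma F_ge: "(t - 1) * \<omega> 1 powr \<alpha> \<le> F t" if "1 \<le> t"
proof -
  have "F 1 - \<omega> 1 powr \<alpha> * 1 \<le> F t - \<omega> 1 powr \<alpha> * t"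
  proof (rule mono_from_deriv[where f = "\<lambda>s. F s - \<omega> 1 powr \<alpha> * s" and f' = "\<lambda>s. \<omega> s powr \<alpha> - \<omega> 1 powr \<alpha>"])
    show "continuous_on {1..t} (\<lambda>s. F s - \<omega> 1 powr \<alpha> * s)"
      by (intro continuous_intros cont_F)
    fix s assume "1 < s" "s < t"
    then show "0 \<le> \<omega> s powr \<alpha> - \<omega> 1 powr \<alpha>"
      using \<omega>_powr_mono[of 1 s] by simp
    show "((\<lambda>s. F s - \<omega> 1 powr \<alpha> * s) has_real_derivative \<omega> s powr \<alpha> - \<omega> 1 powr \<alpha>) (at s)"
      by (rule DERIV_diff[OF deriv_F DERIV_cmult_Id])
  qed (use that in auto)
  then show ?thesis
    using F_pos[of 1] by (simp add: algebra_simps)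
qed

text \<open>\<open>G - \<theta> * F\<close> changes sign: for moderate \<open>t\<close> the weight
  in \<open>G\<close> is still at least \<open>\<theta>\<close>, whereas for large \<open>t\<close>
  one has \<open>G \<le> F powr \<alpha>\<close>, which is sublinear in the unbounded
  \<open>F\<close>.\<close>

lemma matching_point:
  assumes \<theta>: "0 < \<theta>" "\<theta> < 1"
  obtains \<rho> where "0 < \<rho>" "G \<rho> = \<theta> * F \<rho>"
proof -
  define r where "r = ln (1 / \<theta>)"
  have r: "0 < r" "exp (- r) = \<theta>"
    using \<theta> by (auto simp: r_def ln_div)
  \<comment> \<open>The threshold beyond which
    \<open>F powr \<alpha> \<le> \<theta> * F\<close>.\<close>
  define M where "M = (1 / \<theta>) powr (1 / (1 - \<alpha>))"
  have M: "0 < M"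
    using \<theta> by (simp add: M_def)
  \<comment> \<open>Large enough for \<open>F_ge\<close> to give \<open>M \<le> F s\<close>.\<close>
  define s where "s = max r (1 + M / \<omega> 1 powr \<alpha>)"
  have K: "0 < \<omega> 1 powr \<alpha>"
    using \<omega>_pos[of 1] by simp
  have s: "r \<le> s" "1 \<le> s" "M / \<omega> 1 powr \<alpha> \<le> s - 1"
    using M by (auto simp: s_def le_max_iff_disj)
  have "M \<le> (s - 1) * \<omega> 1 powr \<alpha>"
    using s(3) K by (simp add: pos_divide_le_eq)
  then have "M \<le> F s"
    using F_ge[OF s(2)] by linarith
  have "0 < F s"
    using M \<open>M \<le> F s\<close> by linarith
  have "G s \<le> \<omega> s powr \<alpha>"
    using s by (intro G_le) auto
  also have "\<dots> \<le> F s powr \<alpha>"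
    using \<omega>_le_F \<omega>_nonneg \<alpha> by (intro powr_mono2) auto
  also have "\<dots> \<le> \<theta> * F s"
  proof -
    have "M powr (1 - \<alpha>) \<le> F s powr (1 - \<alpha>)"
      using \<open>M \<le> F s\<close> M \<alpha> by (intro powr_mono2) auto
    moreover have "M powr (1 - \<alpha>) = 1 / \<theta>"
      using \<theta> \<alpha> by (simp add: M_def powr_powr)
    ultimately have "1 \<le> \<theta> * F s powr (1 - \<alpha>)"
      using \<theta> by (simp add: divide_le_eq mult.commute)
    then have "F s powr \<alpha> * 1 \<le> F s powr \<alpha> * (\<theta> * F s powr (1 - \<alpha>))"
      by (intro mult_left_mono) auto
    also have "\<dots> = \<theta> * (F s powr \<alpha> * F s powr (1 - \<alpha>))"
      by (simp only: mult_ac)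
    also have "F s powr \<alpha> * F s powr (1 - \<alpha>) = F s"
      unfolding powr_add[symmetric] using \<open>0 < F s\<close> by simp
    finally show ?thesis by simp
  qed
  finally have "G s - \<theta> * F s \<le> 0" by simp
  moreover have "0 \<le> G r - \<theta> * F r"
    using G_ge[of r] r by simp
  moreover have "continuous_on {r..s} (\<lambda>t. G t - \<theta> * F t)"
    by (intro continuous_intros cont_G cont_F)
  ultimately obtain \<rho> where "r \<le> \<rho>" "G \<rho> - \<theta> * F \<rho> = 0"
    using IVT2'[of "\<lambda>t. G t - \<theta> * F t" s 0 r] s by blast
  then show thesis
    using r by (intro that[of \<rho>]) auto
qed

text \<open>An algebra closed under differentiation on \<open>(0, \<infinity>)\<close>, which yields smoothness of the profile there.\<close>

inductive_set smooth_terms :: "(real \<Rightarrow> real) set" where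
  smooth_const: "(\<lambda>_. k) \<in> smooth_terms"
| smooth_\<omega>: "\<omega> \<in> smooth_terms"
| smooth_powr: "(\<lambda>t. \<omega> t powr p) \<in> smooth_terms"
| smooth_F: "F \<in> smooth_terms"
| smooth_G: "G \<in> smooth_terms"
| smooth_add: "f \<in> smooth_terms \<Longrightarrow> g \<in> smooth_terms \<Longrightarrow> (\<lambda>t. f t + g t) \<in> smooth_terms"
| smooth_mult: "f \<in> smooth_terms \<Longrightarrow> g \<in> smooth_terms \<Longrightarrow> (\<lambda>t. f t * g t) \<in> smooth_terms"

text \<open>The derivative of the profile in the syntactic shape that the generating rules
  produce.\<close>

lemma smooth_\<omega>': "(\<lambda>t. 1 / \<Lambda> * (F t + (-1) * \<omega> t)) \<in> smooth_terms"
  by (rule smooth_terms.smooth_mult[OF smooth_terms.smooth_const smooth_terms.smooth_add[OF smooth_terms.smooth_F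
        smooth_terms.smooth_mult[OF smooth_terms.smooth_const smooth_terms.smooth_\<omega>]]])

lemma smooth_deriv:
  "f \<in> smooth_terms \<Longrightarrow> \<exists>g\<in>smooth_terms. \<forall>t>0. (f has_real_derivative g t) (at t)"
proof (induction rule: smooth_terms.induct)
  case (smooth_const k)
  show ?case
  proof (intro bexI allI impI)
    show "((\<lambda>_. k) has_real_derivative 0) (at t)" for t :: real
      by (rule DERIV_const)
  qed (rule smooth_terms.smooth_const)
next
  case smooth_\<omega>
  show ?case
  proof (intro bexI allI impI)
    show "(\<omega> has_real_derivative 1 / \<Lambda> * (F t + (-1) * \<omega> t)) (at t)" for t
      by (rule DERIV_cong[OF deriv_\<omega>]) simp
  qed (rule smooth_\<omega>')
next
  case (smooth_powr p)
  show ?case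
  proof (intro bexI allI impI)
    fix t :: real assume "0 < t"
    show "((\<lambda>t. \<omega> t powr p) has_real_derivative
        (p * \<omega> t powr (p - real 1)) * (1 / \<Lambda> * (F t + (-1) * \<omega> t))) (at t)"
      by (rule DERIV_cong[OF DERIV_fun_powr[OF deriv_\<omega> \<omega>_pos[OF \<open>0 < t\<close>]]]) simp
  qed (rule smooth_terms.smooth_mult[OF smooth_terms.smooth_mult[OF smooth_terms.smooth_const
          smooth_terms.smooth_powr] smooth_\<omega>'])
next
  case smooth_F
  show ?case
  proof (intro bexI allI impI)
    show "(F has_real_derivative \<omega> t powr \<alpha>) (at t)" for t
      by (rule deriv_F)
  qed (rule smooth_terms.smooth_powr)
next
  case smooth_G
  show ?case
  proof (intro bexI allI impI)
    show "(G has_real_derivative \<omega> t powr \<alpha> + (-1) * G t) (at t)" for t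
      by (rule DERIV_cong[OF deriv_G]) simp
  qed (rule smooth_terms.smooth_add[OF smooth_terms.smooth_powr
        smooth_terms.smooth_mult[OF smooth_terms.smooth_const smooth_terms.smooth_G]])
next
  case (smooth_add f g)
  from smooth_add.IH obtain f' g' where *: "f' \<in> smooth_terms" "g' \<in> smooth_terms"
    and f': "\<forall>t>0. (f has_real_derivative f' t) (at t)"
    and g': "\<forall>t>0. (g has_real_derivative g' t) (at t)"
    by (elim bexE)
  show ?case
  proof (intro bexI allI impI)
    fix t :: real assume "0 < t"
    show "((\<lambda>t. f t + g t) has_real_derivative f' t + g' t) (at t)"
      by (rule DERIV_add[OF f'[rule_format, OF \<open>0 < t\<close>] g'[rule_format, OF \<open>0 < t\<close>]])
  qed (rule smooth_terms.smooth_add[OF *])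
next
  case (smooth_mult f g)
  from smooth_mult.IH obtain f' g' where *: "f' \<in> smooth_terms" "g' \<in> smooth_terms"
    and f': "\<forall>t>0. (f has_real_derivative f' t) (at t)"
    and g': "\<forall>t>0. (g has_real_derivative g' t) (at t)"
    by (elim bexE)
  show ?case
  proof (intro bexI allI impI)
    fix t :: real assume "0 < t"
    show "((\<lambda>t. f t * g t) has_real_derivative f' t * g t + g' t * f t) (at t)"
      by (rule DERIV_mult[OF f'[rule_format, OF \<open>0 < t\<close>] g'[rule_format, OF \<open>0 < t\<close>]])
  qed (rule smooth_terms.smooth_add[OF smooth_terms.smooth_mult[OF *(1) smooth_mult.hyps(2)]
        smooth_terms.smooth_mult[OF *(2) smooth_mult.hyps(1)]])
qed

text \<open>The class is transported along \<open>x \<mapsto> \<rho> - c * x\<close>; the inner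
  derivative \<open>- c\<close> is absorbed as a constant term. For \<open>x < \<rho> / c\<close>
  the argument stays positive, where the terms are differentiable.\<close>

lemma smooth_affine:
  assumes f: "f \<in> smooth_terms" and c: "0 < c"
    and eq: "\<And>x. x \<in> {0..<\<rho> / c} \<Longrightarrow> f (\<rho> - c * x) = h x"
  shows "infinitely_differentiable_on h {0..<\<rho> / c}"
proof (rule infinitely_differentiable_onI[where P = "\<lambda>k. k \<in> (\<lambda>f x. f (\<rho> - c * x)) ` smooth_terms"])
  show "(\<lambda>x. f (\<rho> - c * x)) \<in> (\<lambda>f x. f (\<rho> - c * x)) ` smooth_terms"
    by (rule imageI[OF f])
  show "f (\<rho> - c * x) = h x" if "x \<in> {0..<\<rho> / c}" for x
    by (rule eq[OF that])
  fix k assume "k \<in> (\<lambda>f x. f (\<rho> - c * x)) ` smooth_terms"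
  then obtain f where f: "k = (\<lambda>x. f (\<rho> - c * x))" "f \<in> smooth_terms"
    by (rule imageE)
  from smooth_deriv[OF f(2)] obtain g where g: "g \<in> smooth_terms"
    and g': "\<forall>t>0. (f has_real_derivative g t) (at t)"
    by (rule bexE)
  show "\<exists>g. g \<in> (\<lambda>f x. f (\<rho> - c * x)) ` smooth_terms \<and>
      (\<forall>x\<in>{0..<\<rho> / c}. (k has_real_derivative g x) (at x within {0..<\<rho> / c}))"
  proof (intro exI conjI ballI)
    show "(\<lambda>x. g (\<rho> - c * x) * (- c)) \<in> (\<lambda>f x. f (\<rho> - c * x)) ` smooth_terms"
      by (rule image_eqI[OF _ smooth_terms.smooth_mult[OF g smooth_terms.smooth_const[of "- c"]]]) (rule refl)
    fix x assume "x \<in> {0..<\<rho> / c}"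
    then have "0 < \<rho> - c * x"
      using c by (simp add: pos_less_divide_eq mult.commute)
    then have "(f has_real_derivative g (\<rho> - c * x)) (at (\<rho> - c * x))"
      using g' by simp
    moreover have "((\<lambda>x. \<rho> - c * x) has_real_derivative - c) (at x)"
      using DERIV_diff[OF DERIV_const[of \<rho>] DERIV_cmult_Id[of c x]] by simp
    ultimately show "(k has_real_derivative g (\<rho> - c * x) * (- c)) (at x within {0..<\<rho> / c})"
      unfolding f(1) by (rule has_field_derivative_at_within[OF DERIV_chain2])
  qed
qed

end

section \<open>The wave assembled from the rescaled profile\<close>

locale wave_construction = profile_construction +
  fixes \<theta> \<rho> :: real
  assumes \<theta>: "0 < \<theta>" "\<theta> < 1" and \<rho>: "0 < \<rho>" and matching: "G \<rho> = \<theta> * F \<rho>"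
begin

text \<open>For \<open>v = \<omega> (\<rho> - c * x) / F \<rho>\<close> the left side of the
  equation scales with \<open>c\<^sup>2 / F \<rho>\<close> and \<open>v powr \<alpha>\<close> with
  \<open>1 / F \<rho> powr \<alpha>\<close>; equality forces
  \<open>c\<^sup>2 = F \<rho> powr (1 - \<alpha>)\<close>.\<close>

definition c :: real where "c = F \<rho> powr ((1 - \<alpha>) / 2)"

definition R :: real where "R = \<rho> / c"

definition B :: real where "B = 1 - \<omega> \<rho> / F \<rho>"

text \<open>The right branch covers both sides of \<open>R\<close>, since \<open>F\<close>,
  \<open>G\<close> and the profile vanish at nonpositive arguments; only the ignition interface
  needs pasting.\<close>

definition u :: "real \<Rightarrow> real" where
  "u x = (if x \<le> 0 then \<theta> * exp (c * x) else 1 - (F (\<rho> - c * x) - G (\<rho> - c * x)) / F \<rho>)"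

definition u' :: "real \<Rightarrow> real" where
  "u' x = (if x \<le> 0 then \<theta> * (exp (c * x) * c) else c * G (\<rho> - c * x) / F \<rho>)"

definition v :: "real \<Rightarrow> real" where
  "v x = (if x \<le> 0 then 1 - B * exp (c / \<Lambda> * x) else \<omega> (\<rho> - c * x) / F \<rho>)"

definition v' :: "real \<Rightarrow> real" where
  "v' x = (if x \<le> 0 then - (B * (exp (c / \<Lambda> * x) * (c / \<Lambda>)))
    else - (c * (F (\<rho> - c * x) - \<omega> (\<rho> - c * x)) / (\<Lambda> * F \<rho>)))"

lemma F_\<rho>: "0 < F \<rho>"
  by (rule F_pos[OF \<rho>])

lemma c_pos: "0 < c"
  using F_\<rho> by (simp add: c_def)

lemma R_pos: "0 < R"
  using \<rho> c_pos by (simp add: R_def)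

lemma c_sq: "c\<^sup>2 * F \<rho> powr \<alpha> = F \<rho>"
proof -
  have "c\<^sup>2 * F \<rho> powr \<alpha> = F \<rho> powr (1 - \<alpha> + \<alpha>)"
    unfolding c_def powr_half_square powr_add ..
  then show ?thesis using F_\<rho> by simp
qed

lemma deriv_affine: "((\<lambda>x. \<rho> - c * x) has_real_derivative - c) (at x)"
  using DERIV_diff[OF DERIV_const[of \<rho>] DERIV_cmult_Id[of c x]] by simp

lemma deriv_exp_linear: "((\<lambda>x. exp (k * x)) has_real_derivative exp (k * x) * k) (at x)" for k :: real
  by (rule DERIV_fun_exp DERIV_cmult_Id)+

lemmas deriv_F_affine = DERIV_chain2[OF deriv_F deriv_affine]
  and deriv_G_affine = DERIV_chain2[OF deriv_G deriv_affine]
  and deriv_\<omega>_affine = DERIV_chain2[OF deriv_\<omega> deriv_affine]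

lemma deriv_u_right:
  "((\<lambda>x. 1 - (F (\<rho> - c * x) - G (\<rho> - c * x)) / F \<rho>) has_real_derivative c * G (\<rho> - c * x) / F \<rho>) (at x)"
  by (rule DERIV_cong[OF DERIV_diff[OF DERIV_const DERIV_cdivide[OF DERIV_diff[OF deriv_F_affine deriv_G_affine]]]])
    (simp add: algebra_simps)

lemma deriv_v_right:
  "((\<lambda>x. \<omega> (\<rho> - c * x) / F \<rho>) has_real_derivative
    - (c * (F (\<rho> - c * x) - \<omega> (\<rho> - c * x)) / (\<Lambda> * F \<rho>))) (at x)"
  by (rule DERIV_cong[OF DERIV_cdivide[OF deriv_\<omega>_affine]]) (simp add: mult_ac)

lemma deriv_v_left: "((\<lambda>x. 1 - B * exp (c / \<Lambda> * x)) has_real_derivative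
    - (B * (exp (c / \<Lambda> * x) * (c / \<Lambda>)))) (at x)"
  using DERIV_diff[OF DERIV_const[of 1] DERIV_cmult[OF deriv_exp_linear[of "c / \<Lambda>" x], of B]]
  by (rule DERIV_cong) simp

text \<open>The single relation \<open>G \<rho> = \<theta> * F \<rho>\<close> closes the gap in the
  value here and in the slope in \<open>u'_match\<close>.\<close>

lemma u_match: "\<theta> * exp (c * 0) = 1 - (F (\<rho> - c * 0) - G (\<rho> - c * 0)) / F \<rho>"
  using F_\<rho> matching by (simp add: diff_divide_distrib)

lemma u'_match: "\<theta> * (exp (c * 0) * c) = c * G (\<rho> - c * 0) / F \<rho>"
  using F_\<rho> matching by simp

lemma v_match: "1 - B * exp (c / \<Lambda> * 0) = \<omega> (\<rho> - c * 0) / F \<rho>"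
  by (simp add: B_def)

lemma v'_match: "- (B * (exp (c / \<Lambda> * 0) * (c / \<Lambda>)))
    = - (c * (F (\<rho> - c * 0) - \<omega> (\<rho> - c * 0)) / (\<Lambda> * F \<rho>))"
proof -
  have "B = (F \<rho> - \<omega> \<rho>) / F \<rho>"
    using F_\<rho> by (simp add: B_def diff_divide_distrib)
  then show ?thesis by (simp add: mult_ac)
qed

lemma deriv_u: "(u has_real_derivative u' x) (at x)"
  unfolding u_def[abs_def] u'_def
  by (rule deriv_paste[OF DERIV_cmult[OF deriv_exp_linear] deriv_u_right u_match u'_match])

lemma deriv_v: "(v has_real_derivative v' x) (at x)"
  unfolding v_def[abs_def] v'_def
  by (rule deriv_paste[OF deriv_v_left deriv_v_right v_match v'_match])

lemma cont_u': "continuous_on UNIV u'"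
  unfolding u'_def[abs_def]
proof (rule continuous_paste)
  show "continuous_on UNIV (\<lambda>x. \<theta> * (exp (c * x) * c))"
    by (intro continuous_intros)
  show "continuous_on UNIV (\<lambda>x. c * G (\<rho> - c * x) / F \<rho>)"
    by (rule DERIV_continuous_on, rule has_field_derivative_at_within)
      (rule DERIV_cdivide DERIV_cmult deriv_G_affine)+
qed (rule u'_match)

lemma cont_v': "continuous_on UNIV v'"
  unfolding v'_def[abs_def]
proof (rule continuous_paste)
  show "continuous_on UNIV (\<lambda>x. - (B * (exp (c / \<Lambda> * x) * (c / \<Lambda>))))"
    by (intro continuous_intros)
  show "continuous_on UNIV (\<lambda>x. - (c * (F (\<rho> - c * x) - \<omega> (\<rho> - c * x)) / (\<Lambda> * F \<rho>)))"
    by (rule DERIV_continuous_on, rule has_field_derivative_at_within)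
      (rule DERIV_minus DERIV_cdivide DERIV_cmult DERIV_diff deriv_F_affine deriv_\<omega>_affine)+
qed (rule v'_match)

lemma C1: "u C1_differentiable_on UNIV" "v C1_differentiable_on UNIV"
  unfolding C1_differentiable_on_def
  using deriv_u deriv_v cont_u' cont_v' by (auto simp: has_real_derivative_iff_has_vector_derivative)

lemma v_powr: "v x powr \<alpha> = c\<^sup>2 * \<omega> (\<rho> - c * x) powr \<alpha> / F \<rho>" if "0 < x"
proof -
  have "v x powr \<alpha> = \<omega> (\<rho> - c * x) powr \<alpha> / F \<rho> powr \<alpha>"
    using that \<omega>_nonneg F_\<rho> by (simp add: v_def powr_divide)
  also have "\<dots> = c\<^sup>2 * \<omega> (\<rho> - c * x) powr \<alpha> / (c\<^sup>2 * F \<rho> powr \<alpha>)"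
    using c_pos by simp
  finally show ?thesis
    unfolding c_sq .
qed

lemma ode_u_left: "ode_at 1 c u 0 x" if "x < 0"
proof (rule ode_atI[OF deriv_u])
  show "(u' has_real_derivative \<theta> * (exp (c * x) * c * c)) (at x)"
  proof (rule has_field_derivative_transform_within_open)
    show "((\<lambda>x. \<theta> * (exp (c * x) * c)) has_real_derivative \<theta> * (exp (c * x) * c * c)) (at x)"
      by (rule DERIV_cmult DERIV_cmult_right deriv_exp_linear)+
    show "x \<in> {..<0}" using that by simp
  qed (auto simp: u'_def)
qed (use that in \<open>simp add: u'_def\<close>)

lemma ode_v_left: "ode_at \<Lambda> c v 0 x" if "x < 0"
proof (rule ode_atI[OF deriv_v])
  show "(v' has_real_derivative - (B * (exp (c / \<Lambda> * x) * (c / \<Lambda>) * (c / \<Lambda>)))) (at x)"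
  proof (rule has_field_derivative_transform_within_open)
    show "((\<lambda>x. - (B * (exp (c / \<Lambda> * x) * (c / \<Lambda>)))) has_real_derivative
        - (B * (exp (c / \<Lambda> * x) * (c / \<Lambda>) * (c / \<Lambda>)))) (at x)"
      by (rule DERIV_minus DERIV_cmult DERIV_cmult_right deriv_exp_linear)+
    show "x \<in> {..<0}" using that by simp
  qed (auto simp: v'_def)
qed (use that \<Lambda> in \<open>simp add: v'_def\<close>)

lemma ode_u_right: "ode_at 1 c u (- (v x powr \<alpha>)) x" if "0 < x"
proof (rule ode_atI[OF deriv_u])
  let ?t = "\<rho> - c * x"
  show "(u' has_real_derivative c * ((\<omega> ?t powr \<alpha> - G ?t) * - c) / F \<rho>) (at x)"
  proof (rule has_field_derivative_transform_within_open)
    show "((\<lambda>x. c * G (\<rho> - c * x) / F \<rho>) has_real_derivative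
        c * ((\<omega> ?t powr \<alpha> - G ?t) * - c) / F \<rho>) (at x)"
      by (rule DERIV_cdivide DERIV_cmult deriv_G_affine)+
    show "x \<in> {0<..}" using that by simp
  qed (auto simp: u'_def)
  show "1 * (c * ((\<omega> ?t powr \<alpha> - G ?t) * - c) / F \<rho>) - c * u' x = - (v x powr \<alpha>)"
    using that F_\<rho> unfolding v_powr[OF that] by (simp add: u'_def field_simps power2_eq_square)
qed

lemma ode_v_right: "ode_at \<Lambda> c v (v x powr \<alpha>) x" if "0 < x"
proof (rule ode_atI[OF deriv_v])
  let ?t = "\<rho> - c * x"
  let ?D = "- (c * (\<omega> ?t powr \<alpha> * - c - (F ?t - \<omega> ?t) / \<Lambda> * - c) / (\<Lambda> * F \<rho>))"
  show "(v' has_real_derivative ?D) (at x)"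
  proof (rule has_field_derivative_transform_within_open)
    show "((\<lambda>x. - (c * (F (\<rho> - c * x) - \<omega> (\<rho> - c * x)) / (\<Lambda> * F \<rho>))) has_real_derivative ?D) (at x)"
      by (rule DERIV_minus DERIV_cdivide DERIV_cmult DERIV_diff deriv_F_affine deriv_\<omega>_affine)+
    show "x \<in> {0<..}" using that by simp
  qed (auto simp: v'_def)
  have "\<Lambda> * (- (c * (p * - c - q / \<Lambda> * - c) / (\<Lambda> * f))) - c * - (c * q / (\<Lambda> * f)) = c\<^sup>2 * p / f"
    if "f \<noteq> 0" for p q f
    using that \<Lambda> by (simp add: field_simps power2_eq_square)
  then show "\<Lambda> * ?D - c * v' x = v x powr \<alpha>"
    using that F_\<rho> unfolding v_powr[OF that] v'_def by simp
qed

lemma right_of_R: "\<rho> - c * x \<le> 0" if "R \<le> x"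
  using that c_pos by (simp add: R_def pos_divide_le_eq mult.commute)

lemma v_right_of_R: "v x = 0" if "R \<le> x"
  using right_of_R[OF that] that R_pos by (simp add: v_def \<omega>_left)

lemma v_nonneg: "0 \<le> v x"
proof (cases "x \<le> 0")
  case True
  have "B \<le> 1" "0 \<le> B"
    using F_\<rho> \<omega>_nonneg \<omega>_le_F[of \<rho>] by (auto simp: B_def divide_le_eq)
  moreover have "exp (c / \<Lambda> * x) \<le> 1"
    using True c_pos \<Lambda> by (simp add: mult_nonneg_nonpos divide_nonpos_nonneg)
  ultimately have "B * exp (c / \<Lambda> * x) \<le> 1"
    by (simp add: mult_le_one)
  then show ?thesis using True by (simp add: v_def)
next
  case False
  then show ?thesis using \<omega>_nonneg F_\<rho> by (simp add: v_def)
qed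

text \<open>The right formula is also valid at 0, which gives the one-sided smoothness
  there.\<close>

lemma v_eq: "\<omega> (\<rho> - c * x) * (1 / F \<rho>) = v x" if "0 \<le> x"
  using that v_match by (cases "x = 0") (simp_all add: v_def)

lemma u_eq: "1 + (-1 / F \<rho>) * (F (\<rho> - c * x) + (-1) * G (\<rho> - c * x)) = u x" if "0 \<le> x"
  unfolding u_def using that u_match by (cases "x = 0") simp_all

lemma smooth: "infinitely_differentiable_on u {0..<R}" "infinitely_differentiable_on v {0..<R}"
proof -
  have "(\<lambda>t. 1 + (-1 / F \<rho>) * (F t + (-1) * G t)) \<in> smooth_terms"
    by (rule smooth_add[OF smooth_const smooth_mult[OF smooth_const smooth_add[OF smooth_F
              smooth_mult[OF smooth_const smooth_G]]]])
  from smooth_affine[OF this c_pos, of \<rho> u]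
  show "infinitely_differentiable_on u {0..<R}"
    unfolding R_def using u_eq by simp
  have "(\<lambda>t. \<omega> t * (1 / F \<rho>)) \<in> smooth_terms"
    by (rule smooth_mult[OF smooth_\<omega> smooth_const])
  from smooth_affine[OF this c_pos, of \<rho> v]
  show "infinitely_differentiable_on v {0..<R}"
    unfolding R_def using v_eq by simp
qed

lemma u_at_bot: "(u \<longlongrightarrow> 0) at_bot"
proof (rule Lim_transform_eventually)
  show "((\<lambda>x. \<theta> * exp (c * x)) \<longlongrightarrow> 0) at_bot"
    using tendsto_mult_left[OF exp_linear_at_bot[OF c_pos], of \<theta>] by simp
  show "\<forall>\<^sub>F x in at_bot. \<theta> * exp (c * x) = u x"
    using eventually_le_at_bot[of 0] by eventually_elim (simp add: u_def)
qed

lemma v_at_bot: "(v \<longlongrightarrow> 1) at_bot"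
proof (rule Lim_transform_eventually)
  have "0 < c / \<Lambda>"
    using c_pos \<Lambda> by simp
  from tendsto_diff[OF tendsto_const[of 1] tendsto_mult_left[OF exp_linear_at_bot[OF this], of B]]
  show "((\<lambda>x. 1 - B * exp (c / \<Lambda> * x)) \<longlongrightarrow> 1) at_bot"
    by simp
  show "\<forall>\<^sub>F x in at_bot. 1 - B * exp (c / \<Lambda> * x) = v x"
    using eventually_le_at_bot[of 0] by eventually_elim (simp add: v_def)
qed

lemma u_at_top: "(u \<longlongrightarrow> 1) at_top"
proof (rule Lim_transform_eventually[OF tendsto_const])
  show "\<forall>\<^sub>F x in at_top. 1 = u x"
    using eventually_ge_at_top[of R]
  proof eventually_elim
    case (elim x)
    then show ?case
      using right_of_R[OF elim] R_pos by (simp add: u_def F_left G_left)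
  qed
qed

lemma travelling_wave: "travelling_wave \<alpha> \<theta> \<Lambda> c R u v"
  unfolding travelling_wave_def
proof (intro conjI allI impI C1 smooth v_nonneg u_at_bot v_at_bot u_at_top)
  show "ode_at 1 c u 0 x" if "R < x" for x
    \<comment> \<open>The right equation persists beyond \<open>R\<close>; there
      \<open>v x = 0\<close>, and \<open>0 powr \<alpha> = 0\<close> removes the source.\<close>
    using ode_u_right[of x] v_right_of_R[of x] that R_pos by simp
  show "v x = 0" if "R < x" for x
    using v_right_of_R[of x] that by simp
  show "u 0 = \<theta>"
    by (simp add: u_def)
  show "v R = 0"
    by (rule v_right_of_R) simp
  have "v' R = 0"
    using right_of_R[of R] R_pos by (simp add: v'_def F_left \<omega>_left)
  then show "deriv v R = 0"
    using DERIV_imp_deriv[OF deriv_v, of R] by simp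
qed (auto intro: ode_u_left ode_v_left ode_u_right ode_v_right)

end

section \<open>Waves as solutions of the free interface problem\<close>

text \<open>The time derivative of the moving profile is \<open>c * w'\<close>; bringing it to the
  other side reverses the sign of the source.\<close>

lemma heat_eq_at_wave:
  assumes w: "\<And>x. (w has_real_derivative deriv w x) (at x)" and ode: "ode_at \<kappa> c w (- q) (x + c * t)"
  shows "heat_eq_at \<kappa> (\<lambda>t x y. w (x + c * t)) q t x y"
proof -
  let ?W = "\<lambda>t x y::real. w (x + c * t)"
  have w'': "(deriv w has_real_derivative deriv (deriv w) (x + c * t)) (at (x + c * t))"
    and eq: "\<kappa> * deriv (deriv w) (x + c * t) - c * deriv w (x + c * t) = - q"
    using ode by (auto simp: ode_at_def twice_differentiable_at_def DERIV_deriv_iff_real_differentiable)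
  have shift: "((\<lambda>z. z + c * t) has_real_derivative 1) (at z)" for z
    using DERIV_add[OF DERIV_ident DERIV_const[of "c * t"]] by simp
  have time: "((\<lambda>s. x + c * s) has_real_derivative c) (at t)"
    using DERIV_add[OF DERIV_const[of x] DERIV_cmult_Id[of c]] by simp
  have x1: "((\<lambda>z. w (z + c * t)) has_real_derivative deriv w (z + c * t)) (at z)" for z
    using DERIV_chain2[OF w shift] by simp
  then have dx: "deriv (\<lambda>z. w (z + c * t)) = (\<lambda>z. deriv w (z + c * t))"
    by (intro ext DERIV_imp_deriv)
  have x2: "((\<lambda>z. deriv w (z + c * t)) has_real_derivative deriv (deriv w) (x + c * t)) (at x)"
    using DERIV_chain2[OF w'' shift] by simp
  have t1: "((\<lambda>s. w (x + c * s)) has_real_derivative deriv w (x + c * t) * c) (at t)"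
    by (rule DERIV_chain2[OF w time])
  have "(\<lambda>z. w (z + c * t)) differentiable (at z)" for z
    using x1 real_differentiable_def by blast
  then have "twice_differentiable_at (\<lambda>z. ?W t z y) x"
    using x2 unfolding twice_differentiable_at_def dx real_differentiable_def by auto
  moreover have "twice_differentiable_at (\<lambda>z. ?W t x z) y"
    by (simp add: twice_differentiable_at_def)
  moreover have "(\<lambda>s. ?W s x y) differentiable (at t)"
    using t1 real_differentiable_def by blast
  moreover have "d_x ?W t z y = deriv w (z + c * t)" for z
    by (simp add: d_x_def dx)
  then have "d_x (d_x ?W) t x y = deriv (deriv w) (x + c * t)"
    unfolding d_x_def[of "d_x ?W"] using DERIV_imp_deriv[OF x2] by simp
  moreover have "d_y (d_y ?W) t x y = 0"
    by (simp add: d_y_def[abs_def])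
  moreover have "d_t ?W t x y = deriv w (x + c * t) * c"
    unfolding d_t_def by (rule DERIV_imp_deriv[OF t1])
  ultimately show ?thesis
    using eq by (simp add: heat_eq_at_def laplacian_def mult.commute)
qed

text \<open>The interface does not depend on \<open>y\<close>, so the normal derivative is
  \<open>w'\<close> at \<open>x + c * t\<close>, which is continuous on the whole space.\<close>

lemma C1_across_wave:
  assumes w: "\<And>x. (w has_real_derivative deriv w x) (at x)" and cont: "continuous_on UNIV (deriv w)"
  shows "C1_across l (\<lambda>t y. a - c * t) (\<lambda>t x y. w (x + c * t))"
  unfolding C1_across_def
proof (intro allI impI ballI conjI)
  fix t y :: real
  let ?W = "\<lambda>t x y::real. w (x + c * t)"
  have shift: "((\<lambda>z. z + c * s) has_real_derivative 1) (at z)" for s z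
    using DERIV_add[OF DERIV_ident DERIV_const[of "c * s"]] by simp
  have cont_w: "isCont w x" and cont_w': "isCont (deriv w) x" for x
    using DERIV_isCont[OF w] cont by (auto simp: continuous_on_eq_continuous_at)
  have arg: "isCont (\<lambda>(s, x, z::real). x + c * s) p" for p :: "real \<times> real \<times> real"
    unfolding case_prod_unfold by (intro continuous_intros)
  have "isCont (\<lambda>p. w ((\<lambda>(s, x, z::real). x + c * s) p)) (t, a - c * t, y)"
    by (rule isCont_o2[OF arg cont_w])
  then show "isCont (\<lambda>(s, x, z). ?W s x z) (t, a - c * t, y)"
    by (simp add: case_prod_unfold)
  have "d_x ?W s x z = deriv w (x + c * s)" for s x z
    unfolding d_x_def using DERIV_imp_deriv[OF DERIV_chain2[OF w shift]] by simp
  moreover have "d_y ?W s x z = 0" for s x z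
    by (simp add: d_y_def)
  ultimately have eq: "(\<lambda>(s, x, z). (d_x ?W s x z - deriv (\<lambda>y::real. a - c * t) y * d_y ?W s x z)
      / sqrt (1 + (deriv (\<lambda>y::real. a - c * t) y)\<^sup>2)) = (\<lambda>p. deriv w ((\<lambda>(s, x, z::real). x + c * s) p))"
    by (simp add: case_prod_unfold)
  have "isCont (\<lambda>p. deriv w ((\<lambda>(s, x, z::real). x + c * s) p)) (t, a - c * t, y)"
    by (rule isCont_o2[OF arg cont_w'])
  then show "\<exists>L. ((\<lambda>(s, x, z). (d_x ?W s x z - deriv (\<lambda>y::real. a - c * t) y * d_y ?W s x z)
      / sqrt (1 + (deriv (\<lambda>y::real. a - c * t) y)\<^sup>2)) \<longlongrightarrow> L)
      (at (t, a - c * t, y) within {(s, x, z). x \<noteq> a - c * s})"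
    unfolding eq isCont_def using tendsto_within_subset by blast
qed

lemma interface_affine: "interface l (\<lambda>t y. a - c * t)"
  unfolding interface_def by (auto simp: case_prod_unfold intro!: continuous_intros)

lemma (in wave) free_interface_solution:
  "free_interface_solution \<alpha> \<theta> \<Lambda> l (\<lambda>t x y. u (x + c * t)) (\<lambda>t x y. v (x + c * t))
     (\<lambda>t y. - c * t) (\<lambda>t y. R - c * t)"
proof -
  \<comment> \<open>Brings the ignition interface into the form \<open>a - c * t\<close> with
    \<open>a = 0\<close>.\<close>
  have f: "(\<lambda>t y::real. - c * t) = (\<lambda>t y. 0 - c * t)" by simp
  note across = C1_across_wave[OF deriv_u cont_u'] C1_across_wave[OF deriv_v cont_v']
  have bot: "filterlim (\<lambda>x. x + c * t) at_bot at_bot" and top: "filterlim (\<lambda>x. x + c * t) at_top at_top" for t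
    using filterlim_tendsto_add_at_bot_iff[OF tendsto_const[of "c * t"], of "\<lambda>x. x" at_bot]
      filterlim_tendsto_add_at_top_iff[OF tendsto_const[of "c * t"], of "\<lambda>x. x" at_top]
    by (simp_all add: filterlim_ident add.commute)
  have lims: "(u \<longlongrightarrow> 0) at_bot" "(v \<longlongrightarrow> 1) at_bot" "(u \<longlongrightarrow> 1) at_top"
    using wave_facts by simp_all
  \<comment> \<open>The sources are written as negatives, even of 0, to match the sign convention of
    \<open>heat_eq_at_wave\<close>.\<close>
  have left: "ode_at 1 c u (- 0) x" "ode_at \<Lambda> c v (- 0) x" if "x < 0" for x
    using wave_facts that by simp_all
  have mid: "ode_at 1 c u (- (v x powr \<alpha>)) x" "ode_at \<Lambda> c v (- (- (v x powr \<alpha>))) x" if "0 < x" "x < R" for x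
    using wave_facts that by simp_all
  have right: "ode_at 1 c u (- 0) x" if "R < x" for x
    using wave_facts that by simp_all
  show ?thesis
    unfolding free_interface_solution_def f
  proof (intro conjI allI impI ballI interface_affine across)
    fix t y x :: real
    show "0 - c * t < R - c * t"
      using R_pos by simp
    show "0 \<le> v (x + c * t)"
      by (rule v_nonneg)
    show "u (0 - c * t + c * t) = \<theta>" "v (R - c * t + c * t) = 0"
      using u_0 v_R by simp_all
    show "((\<lambda>x. u (x + c * t)) \<longlongrightarrow> 0) at_bot"
      by (rule filterlim_compose[OF lims(1) bot])
    show "((\<lambda>x. v (x + c * t)) \<longlongrightarrow> 1) at_bot"
      by (rule filterlim_compose[OF lims(2) bot])
    show "((\<lambda>x. u (x + c * t)) \<longlongrightarrow> 1) at_top"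
      by (rule filterlim_compose[OF lims(3) top])
    show "heat_eq_at 1 (\<lambda>t x y. u (x + c * t)) 0 t x y" if "x < 0 - c * t"
      by (rule heat_eq_at_wave[OF deriv_u left(1)]) (use that in simp)
    show "heat_eq_at \<Lambda> (\<lambda>t x y. v (x + c * t)) 0 t x y" if "x < 0 - c * t"
      by (rule heat_eq_at_wave[OF deriv_v left(2)]) (use that in simp)
    show "heat_eq_at 1 (\<lambda>t x y. u (x + c * t)) (v (x + c * t) powr \<alpha>) t x y"
      if "0 - c * t < x \<and> x < R - c * t"
      by (rule heat_eq_at_wave[OF deriv_u mid(1)]) (use that in simp_all)
    show "heat_eq_at \<Lambda> (\<lambda>t x y. v (x + c * t)) (- (v (x + c * t) powr \<alpha>)) t x y"
      if "0 - c * t < x \<and> x < R - c * t"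
      by (rule heat_eq_at_wave[OF deriv_v mid(2)]) (use that in simp_all)
    show "heat_eq_at 1 (\<lambda>t x y. u (x + c * t)) 0 t x y" if "R - c * t < x"
      by (rule heat_eq_at_wave[OF deriv_u right]) (use that in simp)
    show "v (x + c * t) = 0" if "R - c * t < x"
      by (rule v_right) (use that in simp)
  qed
qed

theorem theorem1p1:
  fixes \<theta> \<Lambda> l :: real
  assumes "0 < \<theta>" "\<theta> < 1" "0 < \<Lambda>" "0 < l"
  shows
    "(\<forall>\<alpha>. 0 < \<alpha> \<and> \<alpha> < 1 \<longrightarrow>
        (\<exists>c R u v. 0 < c \<and> 0 < R \<and>
           free_interface_solution \<alpha> \<theta> \<Lambda> l
             (\<lambda>t x y. u (x + c * t)) (\<lambda>t x y. v (x + c * t))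
             (\<lambda>t y. - c * t) (\<lambda>t y. R - c * t) \<and>
           travelling_wave \<alpha> \<theta> \<Lambda> c R u v)) \<and>
     (\<forall>(c :: real \<Rightarrow> real) (R :: real \<Rightarrow> real) (u :: real \<Rightarrow> real \<Rightarrow> real) (v :: real \<Rightarrow> real \<Rightarrow> real).
        (\<forall>\<alpha>. 0 < \<alpha> \<and> \<alpha> < 1 \<longrightarrow> 0 < c \<alpha> \<and> travelling_wave \<alpha> \<theta> \<Lambda> (c \<alpha>) (R \<alpha>) (u \<alpha>) (v \<alpha>)) \<longrightarrow>
        (\<forall>\<alpha>. 0 < \<alpha> \<and> \<alpha> < 1 \<longrightarrow> 0 < R \<alpha>) \<and>
        filterlim R at_top (at_left 1) \<and>
        (\<exists>!c\<^sub>0. 0 < c\<^sub>0 \<and> exp (c\<^sub>0\<^sup>2) = 1 / (1 - c\<^sub>0\<^sup>2 * \<theta>)) \<and>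
        (\<forall>c\<^sub>0. 0 < c\<^sub>0 \<and> exp (c\<^sub>0\<^sup>2) = 1 / (1 - c\<^sub>0\<^sup>2 * \<theta>) \<longrightarrow> (R \<longlongrightarrow> c\<^sub>0) (at_right 0)))"
proof (intro conjI allI impI)
  fix \<alpha> :: real assume \<alpha>: "0 < \<alpha> \<and> \<alpha> < 1"
  then interpret P: profile_construction \<alpha> \<Lambda>
    using \<open>0 < \<Lambda>\<close> by unfold_locales auto
  obtain \<rho> where \<rho>: "0 < \<rho>" "P.G \<rho> = \<theta> * P.F \<rho>"
    using P.matching_point[OF assms(1,2)] by blast
  interpret C: wave_construction \<alpha> \<Lambda> \<theta> \<rho>
    by unfold_locales (use \<rho> assms in auto)
  \<comment> \<open>The constructed wave enters the general theory, where every wave was shown to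
    solve the free interface problem.\<close>
  interpret wave \<alpha> \<theta> \<Lambda> C.c C.R C.u C.v
    by unfold_locales (use \<alpha> assms C.c_pos C.travelling_wave in auto)
  show "\<exists>c R u v. 0 < c \<and> 0 < R \<and>
      free_interface_solution \<alpha> \<theta> \<Lambda> l (\<lambda>t x y. u (x + c * t)) (\<lambda>t x y. v (x + c * t))
        (\<lambda>t y. - c * t) (\<lambda>t y. R - c * t) \<and>
      travelling_wave \<alpha> \<theta> \<Lambda> c R u v"
    by (rule exI[of _ C.c], rule exI[of _ C.R], rule exI[of _ C.u], rule exI[of _ C.v])
      (intro conjI C.c_pos C.R_pos free_interface_solution C.travelling_wave)
next
  fix c R :: "real \<Rightarrow> real" and u v :: "real \<Rightarrow> real \<Rightarrow> real"
  assume *: "\<forall>\<alpha>. 0 < \<alpha> \<and> \<alpha> < 1 \<longrightarrow> 0 < c \<alpha> \<and> travelling_wave \<alpha> \<theta> \<Lambda> (c \<alpha>) (R \<alpha>) (u \<alpha>) (v \<alpha>)"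
  have wave: "wave \<alpha> \<theta> \<Lambda> (c \<alpha>) (R \<alpha>) (u \<alpha>) (v \<alpha>)" if "0 < \<alpha>" "\<alpha> < 1" for \<alpha>
    by unfold_locales (use * that assms in auto)
  show "0 < R \<alpha>" if "0 < \<alpha> \<and> \<alpha> < 1" for \<alpha>
    using wave.R_pos[OF wave] that by blast
  show "filterlim R at_top (at_left 1)"
    by (rule filterlim_interface_at_top[OF assms(1-3) wave])
  show "\<exists>!c\<^sub>0. 0 < c\<^sub>0 \<and> exp (c\<^sub>0\<^sup>2) = 1 / (1 - c\<^sub>0\<^sup>2 * \<theta>)"
    unfolding exp_sq_eq_iff by (rule limit_speed[OF assms(1,2)])
  show "(R \<longlongrightarrow> c\<^sub>0) (at_right 0)" if "0 < c\<^sub>0 \<and> exp (c\<^sub>0\<^sup>2) = 1 / (1 - c\<^sub>0\<^sup>2 * \<theta>)" for c\<^sub>0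
    by (rule tendsto_interface[OF assms(1-3) wave]) (use that in \<open>simp_all add: exp_sq_eq_iff\<close>)
qed

end
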